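(* Let $(A,\mathcal H)$ be a left bialgebroid such that ${}_s\mathcal H$ is $A$-flat. (1) If $I$ is a left ideal two-sided coideal in $\mathcal H$ and $B:=\mathcal H^{\mathrm{co}\,\mathcal H/I}$, then $B=\mathcal H^{\mathrm{co}\,\mathcal H/\mathcal HB^+}$. (2) If $B$ is a right $\mathcal H$-comodule $A^o$-subring of $\mathcal H$ via $t$ and $I:=\mathcal HB^+$, then $I=\mathcal H\big(\mathcal H^{\mathrm{co}\,\mathcal H/I}\big)^+$.
   Context: $\Bbbk$ is a field. For a $\Bbbk$-algebra $A$, $A^o$ is its opposite. A left bialgebroid $(A,\mathcal H)$ consists of $\Bbbk$-algebras $A,\mathcal H$, algebra maps $s:A\to\mathcal H$, $t:A^o\to\mathcal H$ with commuting images, and $A$-bilinear maps $\Delta:\mathcal H\to\mathcal H\otimes_A\mathcal H$, $\varepsilon:\mathcal H\to A$ for the bimodule structure $a\cdot h\cdot b=s(a)t(b)h$, where $\mathcal H\otimes_A\mathcal H$ is the quotient of $\mathcal H\otimes\mathcal H$ by the span of $t(a)x\otimes y-x\otimes s(a)y$; such that $(\mathcal H,\Delta,\varepsilon)$ is a coassociative counital $A$-coring, $\Delta$ takes values in $\{\sum_ix_i\otimes_Ay_i:\sum_ix_it(a)\otimes_Ay_i=\sum_ix_i\otimes_Ay_is(a)\ \forall a\}$ and is an algebra map into it (factorwise product), $\varepsilon(xs(\varepsilon(y)))=\varepsilon(xy)=\varepsilon(xt(\varepsilon(y)))$, $\varepsilon(1)=1$. Write $\Delta(x)=\sum x_1\otimes_Ax_2$;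 $\mathcal H^+=\ker\varepsilon$, $B^+=B\cap\mathcal H^+$. "${}_s\mathcal H$ is $A$-flat": $\mathcal H$ is flat as left $A$-module via $s$. A left ideal two-sided coideal is a left ideal $I$ with $\varepsilon(I)=0$ and $\Delta(I)\subseteq$ image of $I\otimes_A\mathcal H+\mathcal H\otimes_AI$. For such $I$ with projection $\pi$, $\mathcal H^{\mathrm{co}\,\mathcal H/I}=\{x:\sum\pi(x_1)\otimes_Ax_2=\pi(1)\otimes_Ax\text{ in }\mathcal H/I\otimes_A\mathcal H\}$. A right $\mathcal H$-comodule $A^o$-subring via $t$ is a subalgebra $B\supseteq t(A)$ with a coassociative counital right $A$-linear coaction $\delta:B\to B\otimes_A\mathcal H$ ($B$ a right $A$-module via $b\cdot a=t(a)b$, $\mathcal H$ left via $s$) such that $(\iota\otimes_A\mathcal H)\delta=\Delta\iota$, $\iota$ the inclusion. (For such $B$, $\mathcal HB^+$ is a left ideal two-sided coideal.) *)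

theory Defs
  imports "HOL-Library.Poly_Mapping"
begin

text \<open>Formal integer combinations ('x =>0 int) model free abelian groups; tensor products
  over A are presented as quotients of free abelian groups by the tensor relations.
  Elements of tensor products are represented by formal sums, equalities are taken
  modulo the subgroup generated by the relations.\<close>

inductive_set zspan :: "('x \<Rightarrow>\<^sub>0 int) set \<Rightarrow> ('x \<Rightarrow>\<^sub>0 int) set" for S where
  zspan_zero: "0 \<in> zspan S"
| zspan_base: "x \<in> S \<Longrightarrow> x \<in> zspan S"
| zspan_diff: "x \<in> zspan S \<Longrightarrow> y \<in> zspan S \<Longrightarrow> x - y \<in> zspan S"

definition zmul :: "int \<Rightarrow> 'g::ab_group_add \<Rightarrow> 'g" where
  "zmul n x = (if 0 \<le> n then (\<Sum>i<nat n. x) else - (\<Sum>i<nat (- n). x))"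

definition fsum_eval :: "('x \<Rightarrow>\<^sub>0 int) \<Rightarrow> ('x \<Rightarrow> 'g::ab_group_add) \<Rightarrow> 'g" where
  "fsum_eval z f = (\<Sum>k\<in>Poly_Mapping.keys z. zmul (Poly_Mapping.lookup z k) (f k))"

definition tensor_rels ::
  "'m set \<Rightarrow> ('m \<Rightarrow> 'm \<Rightarrow> 'm) \<Rightarrow> ('m \<Rightarrow> 'a \<Rightarrow> 'm) \<Rightarrow>
   'n set \<Rightarrow> ('n \<Rightarrow> 'n \<Rightarrow> 'n) \<Rightarrow> ('a \<Rightarrow> 'n \<Rightarrow> 'n) \<Rightarrow> (('m \<times> 'n) \<Rightarrow>\<^sub>0 int) set" where
  "tensor_rels CM addM actM CN addN actN =
     {frag_of (addM m m', n) - frag_of (m, n) - frag_of (m', n) | m m' n. m \<in> CM \<and> m' \<in> CM \<and> n \<in> CN}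
   \<union> {frag_of (m, addN n n') - frag_of (m, n) - frag_of (m, n') | m n n'. m \<in> CM \<and> n \<in> CN \<and> n' \<in> CN}
   \<union> {frag_of (actM m a, n) - frag_of (m, actN a n) | m a n. m \<in> CM \<and> n \<in> CN}"

definition HH_rels :: "('a \<Rightarrow> 'h::{ring,monoid_mult}) \<Rightarrow> ('a \<Rightarrow> 'h) \<Rightarrow> 'h set \<Rightarrow> (('h \<times> 'h) \<Rightarrow>\<^sub>0 int) set" where
  "HH_rels s t C = tensor_rels C (+) (\<lambda>x a. t a * x) UNIV (+) (\<lambda>a y. s a * y)"

definition H3_rels :: "('a \<Rightarrow> 'h::{ring,monoid_mult}) \<Rightarrow> ('a \<Rightarrow> 'h) \<Rightarrow> 'h set \<Rightarrow> (('h \<times> 'h \<times> 'h) \<Rightarrow>\<^sub>0 int) set" where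
  "H3_rels s t C =
     {frag_of (x + x', y, z) - frag_of (x, y, z) - frag_of (x', y, z) | x x' y z. x \<in> C \<and> x' \<in> C}
   \<union> {frag_of (x, y + y', z) - frag_of (x, y, z) - frag_of (x, y', z) | x y y' z. x \<in> C}
   \<union> {frag_of (x, y, z + z') - frag_of (x, y, z) - frag_of (x, y, z') | x y z z'. x \<in> C}
   \<union> {frag_of (t a * x, y, z) - frag_of (x, s a * y, z) | x a y z. x \<in> C}
   \<union> {frag_of (x, t a * y, z) - frag_of (x, y, s a * z) | x a y z. x \<in> C}"

definition k_algebra :: "('k::field \<Rightarrow> 'r::{ring,monoid_mult} \<Rightarrow> 'r) \<Rightarrow> bool" where
  "k_algebra sm \<longleftrightarrow>
     (\<forall>c x y. sm c (x + y) = sm c x + sm c y) \<and> (\<forall>c d x. sm (c + d) x = sm c x + sm d x) \<and>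
     (\<forall>c d x. sm (c * d) x = sm c (sm d x)) \<and> (\<forall>x. sm 1 x = x) \<and>
     (\<forall>c x y. sm c (x * y) = sm c x * y \<and> sm c (x * y) = x * sm c y)"

definition fprod :: "(('h::times \<times> 'h) \<Rightarrow>\<^sub>0 int) \<Rightarrow> (('h \<times> 'h) \<Rightarrow>\<^sub>0 int) \<Rightarrow> (('h \<times> 'h) \<Rightarrow>\<^sub>0 int)" where
  "fprod z w = frag_extend (\<lambda>(x, y). frag_extend (\<lambda>(x', y'). frag_of (x * x', y * y')) w) z"

definition left_bialgebroid ::
  "('k::field \<Rightarrow> 'a::{ring,monoid_mult} \<Rightarrow> 'a) \<Rightarrow> ('k \<Rightarrow> 'h::{ring,monoid_mult} \<Rightarrow> 'h) \<Rightarrow>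
   ('a \<Rightarrow> 'h) \<Rightarrow> ('a \<Rightarrow> 'h) \<Rightarrow> ('h \<Rightarrow> ('h \<times> 'h) \<Rightarrow>\<^sub>0 int) \<Rightarrow> ('h \<Rightarrow> 'a) \<Rightarrow> bool" where
  "left_bialgebroid smA smH s t D eps \<longleftrightarrow>
     k_algebra smA \<and> k_algebra smH \<and>
     \<comment> \<open>s : A \<rightarrow> H and t : A^o \<rightarrow> H are k-algebra maps with commuting images\<close>
     (\<forall>a b. s (a + b) = s a + s b \<and> s (a * b) = s a * s b) \<and> s 1 = 1 \<and> (\<forall>c a. s (smA c a) = smH c (s a)) \<and>
     (\<forall>a b. t (a + b) = t a + t b \<and> t (a * b) = t b * t a) \<and> t 1 = 1 \<and> (\<forall>c a. t (smA c a) = smH c (t a)) \<and>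
     (\<forall>a b. s a * t b = t b * s a) \<and>
     \<comment> \<open>Delta : H \<rightarrow> H \<otimes>_A H is A-bilinear\<close>
     (\<forall>x y. D (x + y) - (D x + D y) \<in> zspan (HH_rels s t UNIV)) \<and>
     (\<forall>a b h. D (s a * t b * h) - frag_extend (\<lambda>(x, y). frag_of (s a * x, t b * y)) (D h)
                \<in> zspan (HH_rels s t UNIV)) \<and>
     \<comment> \<open>eps : H \<rightarrow> A is A-bilinear\<close>
     (\<forall>x y. eps (x + y) = eps x + eps y) \<and> (\<forall>a b h. eps (s a * t b * h) = a * eps h * b) \<and>
     \<comment> \<open>coassociativity in H \<otimes>_A H \<otimes>_A H\<close>
     (\<forall>h. frag_extend (\<lambda>(x, y). frag_extend (\<lambda>(u, v). frag_of (u, v, y)) (D x)) (D h)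
          - frag_extend (\<lambda>(x, y). frag_extend (\<lambda>(u, v). frag_of (x, u, v)) (D y)) (D h)
          \<in> zspan (H3_rels s t UNIV)) \<and>
     \<comment> \<open>counitality\<close>
     (\<forall>h. fsum_eval (D h) (\<lambda>(x, y). s (eps x) * y) = h) \<and>
     (\<forall>h. fsum_eval (D h) (\<lambda>(x, y). t (eps y) * x) = h) \<and>
     \<comment> \<open>Delta takes values in the Takeuchi product\<close>
     (\<forall>h a. frag_extend (\<lambda>(x, y). frag_of (x * t a, y)) (D h)
            - frag_extend (\<lambda>(x, y). frag_of (x, y * s a)) (D h) \<in> zspan (HH_rels s t UNIV)) \<and>
     \<comment> \<open>Delta is an algebra map\<close>
     D 1 - frag_of (1, 1) \<in> zspan (HH_rels s t UNIV) \<and>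
     (\<forall>x y. D (x * y) - fprod (D x) (D y) \<in> zspan (HH_rels s t UNIV)) \<and>
     \<comment> \<open>conditions on eps\<close>
     (\<forall>x y. eps (x * s (eps y)) = eps (x * y) \<and> eps (x * y) = eps (x * t (eps y))) \<and>
     eps 1 = 1"

definition rmodule ::
  "'m set \<Rightarrow> ('m \<Rightarrow> 'm \<Rightarrow> 'm) \<Rightarrow> 'm \<Rightarrow> ('m \<Rightarrow> 'm) \<Rightarrow> ('m \<Rightarrow> 'a::{ring,monoid_mult} \<Rightarrow> 'm) \<Rightarrow> bool" where
  "rmodule C add z neg act \<longleftrightarrow>
     z \<in> C \<and> (\<forall>x\<in>C. \<forall>y\<in>C. add x y \<in> C) \<and> (\<forall>x\<in>C. neg x \<in> C) \<and> (\<forall>x\<in>C. \<forall>a. act x a \<in> C) \<and>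
     (\<forall>x\<in>C. \<forall>y\<in>C. \<forall>w\<in>C. add (add x y) w = add x (add y w)) \<and>
     (\<forall>x\<in>C. \<forall>y\<in>C. add x y = add y x) \<and> (\<forall>x\<in>C. add z x = x) \<and> (\<forall>x\<in>C. add (neg x) x = z) \<and>
     (\<forall>x\<in>C. \<forall>y\<in>C. \<forall>a. act (add x y) a = add (act x a) (act y a)) \<and>
     (\<forall>x\<in>C. \<forall>a b. act x (a + b) = add (act x a) (act x b)) \<and>
     (\<forall>x\<in>C. \<forall>a b. act x (a * b) = act (act x a) b) \<and> (\<forall>x\<in>C. act x 1 = x)"

definition rlinear ::
  "('m \<Rightarrow> 'n) \<Rightarrow> 'm set \<Rightarrow> ('m \<Rightarrow> 'm \<Rightarrow> 'm) \<Rightarrow> ('m \<Rightarrow> 'a \<Rightarrow> 'm) \<Rightarrow>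
   'n set \<Rightarrow> ('n \<Rightarrow> 'n \<Rightarrow> 'n) \<Rightarrow> ('n \<Rightarrow> 'a \<Rightarrow> 'n) \<Rightarrow> bool" where
  "rlinear f CM addM actM CN addN actN \<longleftrightarrow>
     f ` CM \<subseteq> CN \<and> (\<forall>x\<in>CM. \<forall>y\<in>CM. f (addM x y) = addN (f x) (f y)) \<and>
     (\<forall>x\<in>CM. \<forall>a. f (actM x a) = actN (f x) a)"

definition flat_s :: "('a::{ring,monoid_mult} \<Rightarrow> 'h::{ring,monoid_mult}) \<Rightarrow> bool" where
  "flat_s s \<longleftrightarrow>
     (\<forall>(CM :: 'h set set) addM zM negM actM (CN :: 'h set set) addN zN negN actN f.
        rmodule CM addM zM negM actM \<and> rmodule CN addN zN negN actN \<and>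
        rlinear f CM addM actM CN addN actN \<and> inj_on f CM \<longrightarrow>
        (\<forall>z. Poly_Mapping.keys z \<subseteq> CM \<times> UNIV \<longrightarrow>
             frag_extend (\<lambda>(m, h). frag_of (f m, h)) z
               \<in> zspan (tensor_rels CN addN actN UNIV (+) (\<lambda>a h. s a * h)) \<longrightarrow>
             z \<in> zspan (tensor_rels CM addM actM UNIV (+) (\<lambda>a h. s a * h))))"

definition qcls :: "'h::ab_group_add set \<Rightarrow> 'h \<Rightarrow> 'h set" where
  "qcls I x = {y. y - x \<in> I}"

definition qadd :: "'h::ab_group_add set \<Rightarrow> 'h set \<Rightarrow> 'h set \<Rightarrow> 'h set" where
  "qadd I C E = {y. \<exists>c\<in>C. \<exists>e\<in>E. y - (c + e) \<in> I}"

definition qact :: "('a \<Rightarrow> 'h::{ring,monoid_mult}) \<Rightarrow> 'h set \<Rightarrow> 'h set \<Rightarrow> 'a \<Rightarrow> 'h set" where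
  "qact t I C a = {y. \<exists>c\<in>C. y - t a * c \<in> I}"

definition coinv ::
  "('a \<Rightarrow> 'h::{ring,monoid_mult}) \<Rightarrow> ('a \<Rightarrow> 'h) \<Rightarrow> ('h \<Rightarrow> ('h \<times> 'h) \<Rightarrow>\<^sub>0 int) \<Rightarrow> 'h set \<Rightarrow> 'h set" where
  "coinv s t D I = {x. frag_extend (\<lambda>(u, v). frag_of (qcls I u, v)) (D x) - frag_of (qcls I 1, x)
       \<in> zspan (tensor_rels (range (qcls I)) (qadd I) (qact t I) UNIV (+) (\<lambda>a y. s a * y))}"

definition lideal_coideal ::
  "('a \<Rightarrow> 'h::{ring,monoid_mult}) \<Rightarrow> ('a \<Rightarrow> 'h) \<Rightarrow> ('h \<Rightarrow> ('h \<times> 'h) \<Rightarrow>\<^sub>0 int) \<Rightarrow> ('h \<Rightarrow> 'a::zero) \<Rightarrow> 'h set \<Rightarrow> bool" where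
  "lideal_coideal s t D eps I \<longleftrightarrow>
     0 \<in> I \<and> (\<forall>x\<in>I. \<forall>y\<in>I. x + y \<in> I) \<and> (\<forall>x\<in>I. - x \<in> I) \<and> (\<forall>h. \<forall>x\<in>I. h * x \<in> I) \<and>
     (\<forall>x\<in>I. eps x = 0) \<and>
     (\<forall>x\<in>I. \<exists>w. Poly_Mapping.keys w \<subseteq> (I \<times> UNIV) \<union> (UNIV \<times> I) \<and>
                 D x - w \<in> zspan (HH_rels s t UNIV))"

definition plus_part :: "('h \<Rightarrow> 'a::zero) \<Rightarrow> 'h set \<Rightarrow> 'h set" where
  "plus_part eps B = {b \<in> B. eps b = 0}"

definition lmul_span :: "'h::{ring,monoid_mult} set \<Rightarrow> 'h set" where
  "lmul_span S = {sum_list (map (\<lambda>(h, b). h * b) l) | l. \<forall>p\<in>set l. snd p \<in> S}"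

definition comod_subring ::
  "('k::field \<Rightarrow> 'h::{ring,monoid_mult} \<Rightarrow> 'h) \<Rightarrow> ('a \<Rightarrow> 'h) \<Rightarrow> ('a \<Rightarrow> 'h) \<Rightarrow>
   ('h \<Rightarrow> ('h \<times> 'h) \<Rightarrow>\<^sub>0 int) \<Rightarrow> ('h \<Rightarrow> 'a) \<Rightarrow> 'h set \<Rightarrow> ('h \<Rightarrow> ('h \<times> 'h) \<Rightarrow>\<^sub>0 int) \<Rightarrow> bool" where
  "comod_subring smH s t D eps B delta \<longleftrightarrow>
     \<comment> \<open>B is a k-subalgebra containing t(A)\<close>
     0 \<in> B \<and> 1 \<in> B \<and> (\<forall>x\<in>B. \<forall>y\<in>B. x + y \<in> B \<and> x * y \<in> B) \<and> (\<forall>x\<in>B. - x \<in> B) \<and>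
     (\<forall>c. \<forall>x\<in>B. smH c x \<in> B) \<and> range t \<subseteq> B \<and>
     \<comment> \<open>delta : B \<rightarrow> B \<otimes>_A H, additive and right A-linear\<close>
     (\<forall>b\<in>B. Poly_Mapping.keys (delta b) \<subseteq> B \<times> UNIV) \<and>
     (\<forall>b\<in>B. \<forall>b'\<in>B. delta (b + b') - (delta b + delta b') \<in> zspan (HH_rels s t B)) \<and>
     (\<forall>b\<in>B. \<forall>a. delta (t a * b) - frag_extend (\<lambda>(x, y). frag_of (x, t a * y)) (delta b)
                   \<in> zspan (HH_rels s t B)) \<and>
     \<comment> \<open>coassociativity in B \<otimes>_A H \<otimes>_A H\<close>
     (\<forall>b\<in>B. frag_extend (\<lambda>(x, y). frag_extend (\<lambda>(u, v). frag_of (u, v, y)) (delta x)) (delta b)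
            - frag_extend (\<lambda>(x, y). frag_extend (\<lambda>(u, v). frag_of (x, u, v)) (D y)) (delta b)
            \<in> zspan (H3_rels s t B)) \<and>
     \<comment> \<open>counitality\<close>
     (\<forall>b\<in>B. fsum_eval (delta b) (\<lambda>(x, y). t (eps y) * x) = b) \<and>
     \<comment> \<open>(iota \<otimes>_A H) delta = Delta iota\<close>
     (\<forall>b\<in>B. delta b - D b \<in> zspan (HH_rels s t UNIV))"

end

theory Submission
  imports Defs
begin

text \<open>The maps \<open>I \<mapsto> \<H>\<^bsup>co \<H>/I\<^esup>\<close> and \<open>B \<mapsto> \<H>B\<^sup>+\<close> form a Galois connection: \<open>\<H>(\<H>\<^bsup>co \<H>/I\<^esup>)\<^sup>+ \<subseteq> I\<close> follows by
  applying \<open>\<epsilon>\<close> to the second tensor factor, and \<open>B \<subseteq> \<H>\<^bsup>co \<H>/\<H>B\<^sup>+\<^esup>\<close> holds whenever \<open>\<Delta>(B)\<close> lies in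
  the image of \<open>B \<otimes> \<H>\<close>. This settles (2). For (1), flatness shows that \<open>\<Delta>\<close> maps the coinvariants
  \<open>B\<close> of \<open>\<H>/I\<close> into the image of \<open>B \<otimes> \<H>\<close>. The module \<open>\<H>/I \<otimes> \<H>\<close> that this argument tests
  flatness on is not carried by a set of subsets of \<open>\<H>\<close>, to which the flatness hypothesis is
  restricted; so only the flatness test for right ideals of \<open>A\<close> is taken from the hypothesis, and
  injectivity is extended to arbitrary modules by adjoining one generator at a time.\<close>

section \<open>Generated subgroups of free abelian groups\<close>

lemma zspan_uminus: "x \<in> zspan S \<Longrightarrow> - x \<in> zspan S"
  using zspan_diff[OF zspan_zero] by fastforce

lemma zspan_add: "x \<in> zspan S \<Longrightarrow> y \<in> zspan S \<Longrightarrow> x + y \<in> zspan S"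
  using zspan_diff[OF _ zspan_uminus] by fastforce

lemma zspan_trans: "x - y \<in> zspan S \<Longrightarrow> y - z \<in> zspan S \<Longrightarrow> x - z \<in> zspan S"
  using zspan_add by fastforce

lemma zspan_sym: "x - y \<in> zspan S \<Longrightarrow> y - x \<in> zspan S"
  using zspan_uminus by fastforce

lemma zspan_cong: "x - y \<in> zspan S \<Longrightarrow> x \<in> zspan S \<longleftrightarrow> y \<in> zspan S"
  using zspan_add[of "x - y" S y] zspan_diff[of x S "x - y"] by auto

lemma zspan_mono: "x \<in> zspan S \<Longrightarrow> S \<subseteq> T \<Longrightarrow> x \<in> zspan T"
  by (induction rule: zspan.induct) (auto intro: zspan.intros)

text \<open>Maps between presented tensor products are given on generators and checked on relations;
  the check makes them well defined on the quotient.\<close>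

lemma zspan_frag_map:
  assumes "z \<in> zspan S" "\<And>x. x \<in> S \<Longrightarrow> frag_extend f x \<in> zspan T"
  shows "frag_extend f z \<in> zspan T"
  using assms(1)
  by (induction rule: zspan.induct) (auto simp: frag_extend_diff assms(2) intro: zspan.intros)

lemma zspan_frag_extend:
  assumes "\<And>k. k \<in> Poly_Mapping.keys z \<Longrightarrow> f k \<in> zspan S"
  shows "frag_extend f z \<in> zspan S"
  using order_refl[of "Poly_Mapping.keys z"]
  by (induction z rule: frag_induction)
     (auto simp: frag_extend_diff assms intro: zspan.intros)

lemma frag_extend_diff_fun:
  "frag_extend f z - frag_extend g z = frag_extend (\<lambda>k. f k - g k) z"
  using subset_UNIV[of "Poly_Mapping.keys z"]
proof (induction z rule: frag_induction)
  case (diff a b)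
  then show ?case by (simp add: frag_extend_diff flip: diff)
qed auto

lemma frag_extend_cong_zspan:
  assumes "\<And>k. k \<in> Poly_Mapping.keys z \<Longrightarrow> f k - g k \<in> zspan S"
  shows "frag_extend f z - frag_extend g z \<in> zspan S"
  unfolding frag_extend_diff_fun using assms by (rule zspan_frag_extend)

lemma frag_extend_frag_extend:
  "frag_extend f (frag_extend g z) = frag_extend (\<lambda>x. frag_extend f (g x)) z"
  using subset_UNIV[of "Poly_Mapping.keys z"]
  by (induction z rule: frag_induction) (auto simp: frag_extend_diff)

lemma frag_extend_of_id: "frag_extend frag_of z = z"
  by (rule frag_expansion[symmetric])

lemma frag_extend_frag_of_pair [simp]: "frag_extend (\<lambda>(x, y). frag_of (x, y)) z = z"
  using frag_extend_of_id[of z] by (simp add: case_prod_unfold)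

text \<open>Maps such as \<open>x \<mapsto> frag_of (x, y)\<close> are additive only modulo
  relations, so even their vanishing at \<open>0\<close> has to be derived, from
  \<open>0 + 0 = 0\<close>.\<close>

lemma additive_mod_zero:
  fixes \<psi> :: "'g::ab_group_add \<Rightarrow> 'x \<Rightarrow>\<^sub>0 int"
  assumes "\<psi> (0 + 0) - \<psi> 0 - \<psi> 0 \<in> zspan S"
  shows "\<psi> 0 \<in> zspan S"
  using zspan_uminus[OF assms] by simp

lemma additive_mod_diff:
  fixes \<psi> :: "'g::ab_group_add \<Rightarrow> 'x \<Rightarrow>\<^sub>0 int"
  assumes "\<psi> (x - y + y) - \<psi> (x - y) - \<psi> y \<in> zspan S"
  shows "\<psi> (x - y) - (\<psi> x - \<psi> y) \<in> zspan S"
  using zspan_uminus[OF assms] by (simp add: algebra_simps)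

section \<open>Evaluation of formal sums\<close>

lemma zmul_add1: "zmul (i + 1) x = zmul i x + x"
proof (cases "i \<ge> 0")
  case True
  then have "nat (i + 1) = Suc (nat i)" by simp
  with True show ?thesis by (simp add: zmul_def add.commute)
next
  case False
  then have "nat (- i) = Suc (nat (- (i + 1)))" by simp
  with False show ?thesis
    by (cases "i = -1") (auto simp: zmul_def)
qed

lemma zmul_0 [simp]: "zmul 0 x = 0" and zmul_1 [simp]: "zmul 1 x = x"
  by (simp_all add: zmul_def)

lemma zmul_add: "zmul (i + j) x = zmul i x + zmul j x"
proof (induction i rule: int_induct[where k = 0])
  case (step1 i)
  then show ?case using zmul_add1[of "i + j" x] zmul_add1[of i x]
    by (simp add: algebra_simps)
next
  case (step2 i)
  have "i + j = (i - 1 + j) + 1" by simp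
  then have "zmul (i + j) x = zmul (i - 1 + j) x + x" by (metis zmul_add1)
  moreover have "zmul i x = zmul (i - 1) x + x" using zmul_add1[of "i - 1" x] by simp
  ultimately show ?case using step2 by (simp add: algebra_simps)
qed simp

lemma fsum_eval_superset:
  assumes "finite K" "Poly_Mapping.keys z \<subseteq> K"
  shows "fsum_eval z f = (\<Sum>k\<in>K. zmul (Poly_Mapping.lookup z k) (f k))"
  unfolding fsum_eval_def using assms
  by (intro sum.mono_neutral_left) (auto simp: in_keys_iff)

lemma fsum_eval_add: "fsum_eval (z + w) f = fsum_eval z f + fsum_eval w f"
proof -
  let ?K = "Poly_Mapping.keys z \<union> Poly_Mapping.keys w"
  have "Poly_Mapping.keys (z + w) \<subseteq> ?K" by (rule Poly_Mapping.keys_add)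
  then show ?thesis
    by (simp add: fsum_eval_superset[of ?K] lookup_add zmul_add sum.distrib)
qed

lemma fsum_eval_diff: "fsum_eval (z - w) f = fsum_eval z f - fsum_eval w f"
  using fsum_eval_add[of "z - w" w f] by (simp add: algebra_simps)

lemma fsum_eval_0 [simp]: "fsum_eval 0 f = 0"
  by (simp add: fsum_eval_def)

lemma fsum_eval_of [simp]: "fsum_eval (frag_of k) f = f k"
  by (simp add: fsum_eval_def)

lemma fsum_eval_uminus: "fsum_eval (- z) f = - fsum_eval z f"
  using fsum_eval_diff[of 0 z f] by simp

text \<open>Well-definedness of maps from a presented tensor product to a group modulo a subgroup
  \<open>G\<close>; below, \<open>G\<close> is a left ideal or \<open>{0}\<close>.\<close>

lemma fsum_eval_zspan:
  assumes "z \<in> zspan S" "\<And>x. x \<in> S \<Longrightarrow> fsum_eval x f \<in> G"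
    "0 \<in> G" "\<And>x y. x \<in> G \<Longrightarrow> y \<in> G \<Longrightarrow> x - y \<in> G"
  shows "fsum_eval z f \<in> G"
  using assms(1) by induction (auto simp: fsum_eval_diff assms)

lemma fsum_eval_frag_of: "fsum_eval z frag_of = z"
  using subset_UNIV[of "Poly_Mapping.keys z"]
  by (induction z rule: frag_induction) (auto simp: fsum_eval_diff)

text \<open>Moves a sum into or out of a tensor factor, as in
  \<open>1 \<otimes> \<Sum> g k = \<Sum> 1 \<otimes> g k\<close>.\<close>

lemma additive_mod_fsum_eval:
  fixes \<psi> :: "'g::ab_group_add \<Rightarrow> 'x \<Rightarrow>\<^sub>0 int"
  assumes "\<And>x y. \<psi> (x + y) - \<psi> x - \<psi> y \<in> zspan S"
  shows "\<psi> (fsum_eval z g) - frag_extend (\<lambda>k. \<psi> (g k)) z \<in> zspan S"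
  using subset_UNIV[of "Poly_Mapping.keys z"]
proof (induction z rule: frag_induction)
  case (diff a b)
  have "\<psi> (fsum_eval a g - fsum_eval b g) - (\<psi> (fsum_eval a g) - \<psi> (fsum_eval b g)) \<in> zspan S"
    by (intro additive_mod_diff assms)
  from zspan_add[OF this zspan_diff[OF diff]]
  show ?case by (simp add: fsum_eval_diff frag_extend_diff algebra_simps)
qed (auto simp: zspan_zero intro: additive_mod_zero assms)

section \<open>Flatness\<close>

lemma tensor_rels_addl:
  "m \<in> CM \<Longrightarrow> m' \<in> CM \<Longrightarrow> n \<in> CN \<Longrightarrow>
    frag_of (addM m m', n) - frag_of (m, n) - frag_of (m', n) \<in> tensor_rels CM addM actM CN addN actN"
  unfolding tensor_rels_def by blast

lemma tensor_rels_addr: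
  "m \<in> CM \<Longrightarrow> n \<in> CN \<Longrightarrow> n' \<in> CN \<Longrightarrow>
    frag_of (m, addN n n') - frag_of (m, n) - frag_of (m, n') \<in> tensor_rels CM addM actM CN addN actN"
  unfolding tensor_rels_def by blast

lemma tensor_rels_act:
  "m \<in> CM \<Longrightarrow> n \<in> CN \<Longrightarrow>
    frag_of (actM m a, n) - frag_of (m, actN a n) \<in> tensor_rels CM addM actM CN addN actN"
  unfolding tensor_rels_def by blast

lemma tensor_rels_cases [consumes 1, case_names addl addr act]:
  assumes "x \<in> tensor_rels CM addM actM CN addN actN"
  obtains
    m m' n where "m \<in> CM" "m' \<in> CM" "n \<in> CN"
      "x = frag_of (addM m m', n) - frag_of (m, n) - frag_of (m', n)"
  | m n n' where "m \<in> CM" "n \<in> CN" "n' \<in> CN"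
      "x = frag_of (m, addN n n') - frag_of (m, n) - frag_of (m, n')"
  | m a n where "m \<in> CM" "n \<in> CN" "x = frag_of (actM m a, n) - frag_of (m, actN a n)"
  using assms unfolding tensor_rels_def by blast


text \<open>The map \<open>a \<otimes> h \<mapsto> s a * h\<close> factors as \<open>\<aa> \<otimes>
  \<H> \<rightarrow> A \<otimes> \<H> \<cong> \<H>\<close>, and flatness makes the first arrow
  injective.\<close>

lemma flat_s_right_ideal:
  fixes s :: "'a::{ring,monoid_mult} \<Rightarrow> 'h::{ring,monoid_mult}" and \<aa> :: "'a set"
  assumes flat: "flat_s s" and inj: "inj s"
    and s_add: "\<And>a b. s (a + b) = s a + s b"
    and s_mult: "\<And>a b. s (a * b) = s a * s b" and s_1: "s 1 = 1"
    and ideal_0: "0 \<in> \<aa>" and ideal_diff: "\<And>a b. a \<in> \<aa> \<Longrightarrow> b \<in> \<aa> \<Longrightarrow> a - b \<in> \<aa>"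
    and ideal_mult: "\<And>a b. a \<in> \<aa> \<Longrightarrow> a * b \<in> \<aa>"
    and keys: "Poly_Mapping.keys z \<subseteq> \<aa> \<times> UNIV"
    and eval: "fsum_eval z (\<lambda>(a, h). s a * h) = 0"
  shows "z \<in> zspan (tensor_rels \<aa> (+) (*) UNIV (+) (\<lambda>a h. s a * h))"
proof -
  text \<open>The flatness hypothesis only speaks about modules whose elements are sets of elements
    of \<open>\<H>\<close>, so the ideal is encoded by the singletons \<open>{s a}\<close>.\<close>
  define C :: "'a set \<Rightarrow> 'h set set" where "C X = (\<lambda>a. {s a}) ` X" for X
  define add :: "'h set \<Rightarrow> 'h set \<Rightarrow> 'h set" where "add X Y = {the_elem X + the_elem Y}" for X Y
  define neg :: "'h set \<Rightarrow> 'h set" where "neg X = {- the_elem X}" for X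
  define act :: "'h set \<Rightarrow> 'a \<Rightarrow> 'h set" where "act X a = {the_elem X * s a}" for X a
  define z' where "z' = frag_extend (\<lambda>(a, h). frag_of ({s a}, h)) z"
  let ?T = "\<lambda>X. tensor_rels (C X) add act UNIV (+) (\<lambda>a h. s a * h)"
  have s_0: "s 0 = 0" using s_add[of 0 0] by simp
  have s_uminus: "s (- a) = - s a" for a
    using s_add[of a "- a"] s_0 by (simp add: eq_neg_iff_add_eq_0 add.commute)
  have add_s: "add {s a} {s b} = {s (a + b)}" for a b by (simp add: add_def s_add)
  have neg_s: "neg {s a} = {s (- a)}" for a by (simp add: neg_def s_uminus)
  have act_s: "act {s a} b = {s (a * b)}" for a b by (simp add: act_def s_mult)
  have ideal_uminus: "- a \<in> \<aa>" if "a \<in> \<aa>" for a using ideal_diff[OF ideal_0 that] by simp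
  have ideal_add: "a + b \<in> \<aa>" if "a \<in> \<aa>" "b \<in> \<aa>" for a b
    using ideal_diff[OF that(1) ideal_uminus[OF that(2)]] by simp
  have rmod: "rmodule (C X) add {s 0} neg act"
    if "0 \<in> X" "\<And>a. a \<in> X \<Longrightarrow> - a \<in> X" "\<And>a b. a \<in> X \<Longrightarrow> b \<in> X \<Longrightarrow> a + b \<in> X"
      "\<And>a b. a \<in> X \<Longrightarrow> a * b \<in> X" for X
    using that unfolding rmodule_def C_def
    by (auto simp: add_s neg_s act_s algebra_simps)
  have "C \<aa> \<subseteq> C UNIV" by (auto simp: C_def)
  then have lin: "rlinear id (C \<aa>) add act (C UNIV) add act" by (auto simp: rlinear_def)
  have keys': "Poly_Mapping.keys z' \<subseteq> C \<aa> \<times> UNIV"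
    unfolding z'_def using keys by (rule_tac order_trans[OF keys_frag_extend]) (auto simp: C_def)
  let ?\<psi> = "\<lambda>h. frag_of ({s 1}, h)"
  have add_r: "?\<psi> (x + y) - ?\<psi> x - ?\<psi> y \<in> zspan (?T UNIV)" for x y
    by (rule zspan_base) (auto simp: tensor_rels_def C_def)
  \<comment> \<open>In \<open>A \<otimes> \<H>\<close> scalars move to the right,
    \<open>a \<otimes> h = 1 \<otimes> s a * h\<close>, so \<open>z'\<close> becomes
    \<open>1 \<otimes> 0\<close> by \<open>eval\<close>.\<close>
  have "z' - frag_extend (\<lambda>(a, h). frag_of ({s 1}, s a * h)) z \<in> zspan (?T UNIV)"
    unfolding z'_def
  proof (rule frag_extend_cong_zspan, clarify)
    fix a h
    have "frag_of (act {s 1} a, h) - frag_of ({s 1}, s a * h) \<in> ?T UNIV"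
      by (rule tensor_rels_act) (auto simp: C_def)
    then show "frag_of ({s a}, h) - frag_of ({s 1}, s a * h) \<in> zspan (?T UNIV)"
      by (auto simp: act_s intro: zspan_base)
  qed
  moreover have "frag_extend (\<lambda>(a, h). frag_of ({s 1}, s a * h)) z \<in> zspan (?T UNIV)"
  proof -
    have "?\<psi> 0 \<in> zspan (?T UNIV)" by (rule additive_mod_zero) (rule add_r)
    moreover have "?\<psi> (fsum_eval z (\<lambda>(a, h). s a * h))
        - frag_extend (\<lambda>k. ?\<psi> ((\<lambda>(a, h). s a * h) k)) z \<in> zspan (?T UNIV)"
      by (rule additive_mod_fsum_eval) (rule add_r)
    ultimately have "?\<psi> 0 - (?\<psi> 0 - frag_extend (\<lambda>k. ?\<psi> ((\<lambda>(a, h). s a * h) k)) z) \<in> zspan (?T UNIV)"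
      unfolding eval by (rule zspan_diff)
    then show ?thesis by (simp add: case_prod_unfold)
  qed
  ultimately have "z' \<in> zspan (?T UNIV)" using zspan_cong by blast
  then have "frag_extend (\<lambda>(m, h). frag_of (id m, h)) z' \<in> zspan (?T UNIV)" by simp
  with keys' have "z' \<in> zspan (?T \<aa>)"
  proof (rule flat[unfolded flat_s_def, rule_format, rotated 1])
    show "rmodule (C \<aa>) add {s 0} neg act \<and> rmodule (C UNIV) add {s 0} neg act \<and>
        rlinear id (C \<aa>) add act (C UNIV) add act \<and> inj_on id (C \<aa>)"
      by (intro conjI rmod lin ideal_0 ideal_uminus ideal_add ideal_mult inj_on_id) auto
  qed
  \<comment> \<open>Decodes \<open>{s a}\<close> to \<open>a\<close>, which is possible since
    \<open>s\<close> is injective.\<close>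
  then have "frag_extend (\<lambda>(X, h). frag_of (inv s (the_elem X), h)) z'
      \<in> zspan (tensor_rels \<aa> (+) (*) UNIV (+) (\<lambda>a h. s a * h))"
  proof (rule zspan_frag_map, goal_cases)
    case (1 x)
    then show ?case
      by (intro zspan_base)
         (fastforce simp: tensor_rels_def C_def add_s act_s frag_extend_diff inj inv_f_f)
  qed
  moreover have "frag_extend (\<lambda>(X, h). frag_of (inv s (the_elem X), h)) z' = z"
    by (simp add: z'_def frag_extend_frag_extend case_prod_unfold inj inv_f_f frag_extend_of_id)
  ultimately show ?thesis by simp
qed

section \<open>Modules presented as quotients by \<open>R\<close>, and injectivity after tensoring
  with \<open>\<H>\<close>\<close>

locale module_presentation =
  fixes R :: "'g::ab_group_add set" and act :: "'g \<Rightarrow> 'a::{ring,monoid_mult} \<Rightarrow> 'g"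
  assumes R_0: "0 \<in> R" and R_diff: "x \<in> R \<Longrightarrow> y \<in> R \<Longrightarrow> x - y \<in> R"
    and R_act: "x \<in> R \<Longrightarrow> act x a \<in> R"
    and act_add: "act (x + y) a = act x a + act y a"
    and act_distrib: "act x (a + b) - act x a - act x b \<in> R"
    and act_mult: "act x (a * b) = act (act x a) b"
    and act_1: "act x 1 = x"
begin

lemma act_diff: "act (x - y) a = act x a - act y a"
  using act_add[of "x - y" y a] by (simp add: algebra_simps)

lemma R_uminus: "x \<in> R \<Longrightarrow> - x \<in> R"
  using R_diff[OF R_0] by fastforce

lemma act_0_right: "act x 0 \<in> R"
  using R_uminus[OF act_distrib[of x 0 0]] by simp

lemma act_diff_right: "act x (a - b) - (act x a - act x b) \<in> R"
  using R_uminus[OF act_distrib[of x "a - b" b]] by (simp add: algebra_simps)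

text \<open>Submodules of the quotient of \<open>'g\<close> by \<open>R\<close> are represented by
  their preimages in \<open>'g\<close>.\<close>

definition submod :: "'g set \<Rightarrow> bool" where
  "submod P \<longleftrightarrow> R \<subseteq> P \<and> (\<forall>x\<in>P. \<forall>y\<in>P. x - y \<in> P) \<and> (\<forall>x\<in>P. \<forall>a. act x a \<in> P)"

lemma submodD:
  assumes "submod P"
  shows "x \<in> R \<Longrightarrow> x \<in> P" "x \<in> P \<Longrightarrow> y \<in> P \<Longrightarrow> x - y \<in> P" "x \<in> P \<Longrightarrow> act x a \<in> P"
    "0 \<in> P" "x \<in> P \<Longrightarrow> - x \<in> P" "x \<in> P \<Longrightarrow> y \<in> P \<Longrightarrow> x + y \<in> P"
proof -
  show 0: "x \<in> R \<Longrightarrow> x \<in> P" and d: "x \<in> P \<Longrightarrow> y \<in> P \<Longrightarrow> x - y \<in> P" "x \<in> P \<Longrightarrow> act x a \<in> P" for x y a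
    using assms unfolding submod_def by blast+
  show z: "0 \<in> P" using R_0 0 by blast
  show u: "x \<in> P \<Longrightarrow> - x \<in> P" for x using d(1)[OF z] by fastforce
  show "x \<in> P \<Longrightarrow> y \<in> P \<Longrightarrow> x + y \<in> P" using d(1)[OF _ u] by fastforce
qed

lemma submod_cong: "submod P \<Longrightarrow> x - y \<in> R \<Longrightarrow> x \<in> P \<longleftrightarrow> y \<in> P"
  using submodD(1)[of P "x - y"] submodD(6)[of P "x - y" y] submodD(2)[of P x "x - y"] by auto

text \<open>For a submodule \<open>P\<close> this presents \<open>P/R \<otimes> \<H>\<close> on the
  generators \<open>P \<times> \<H>\<close>: killing the pairs with left entry in \<open>R\<close>
  replaces passing to cosets.\<close>

definition trels :: "('a \<Rightarrow> 'h::{ring,monoid_mult}) \<Rightarrow> 'g set \<Rightarrow> (('g \<times> 'h) \<Rightarrow>\<^sub>0 int) set" where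
  "trels s P = tensor_rels P (+) act UNIV (+) (\<lambda>a h. s a * h) \<union> {frag_of (r, h) | r h. r \<in> R}"

lemma trels_R: "r \<in> R \<Longrightarrow> frag_of (r, h) \<in> zspan (trels s P)"
  unfolding trels_def by (rule zspan_base) blast

lemma trels_addl: "m \<in> P \<Longrightarrow> m' \<in> P \<Longrightarrow>
    frag_of (m + m', h) - frag_of (m, h) - frag_of (m', h) \<in> zspan (trels s P)"
  unfolding trels_def by (intro zspan_base UnI1 tensor_rels_addl) auto

lemma trels_addr: "m \<in> P \<Longrightarrow>
    frag_of (m, h + h') - frag_of (m, h) - frag_of (m, h') \<in> zspan (trels s P)"
  unfolding trels_def by (intro zspan_base UnI1 tensor_rels_addr) auto

lemma trels_act: "m \<in> P \<Longrightarrow> frag_of (act m a, h) - frag_of (m, s a * h) \<in> zspan (trels s P)"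
  unfolding trels_def by (intro zspan_base UnI1 tensor_rels_act) auto

lemma trels_diffl:
  assumes "submod P" "x \<in> P" "y \<in> P"
  shows "frag_of (x - y, h) - (frag_of (x, h) - frag_of (y, h)) \<in> zspan (trels s P)"
  using assms by (intro additive_mod_diff trels_addl) (auto intro: submodD)

lemma trels_cong:
  assumes "submod P" "y \<in> P" "x - y \<in> R"
  shows "frag_of (x, h) - frag_of (y, h) \<in> zspan (trels s P)"
proof -
  have "frag_of (x - y + y, h) - frag_of (x - y, h) - frag_of (y, h) \<in> zspan (trels s P)"
    using assms by (intro trels_addl) (auto intro: submodD)
  from zspan_add[OF this trels_R[OF assms(3), of h]] show ?thesis by simp
qed

lemma trels_cases [consumes 1, case_names addl addr act R]:
  assumes "x \<in> trels s P"
  obtains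
    m m' h where "m \<in> P" "m' \<in> P" "x = frag_of (m + m', h) - frag_of (m, h) - frag_of (m', h)"
  | m h h' where "m \<in> P" "x = frag_of (m, h + h') - frag_of (m, h) - frag_of (m, h')"
  | m a h where "m \<in> P" "x = frag_of (act m a, h) - frag_of (m, s a * h)"
  | r h where "r \<in> R" "x = frag_of (r, h)"
  using assms unfolding trels_def by (blast elim: tensor_rels_cases)

text \<open>A derivation of \<open>z = 0\<close> uses finitely many relations and hence finitely
  many module elements; it is valid over any set containing them. This reduces arbitrary modules to
  finitely many adjunctions.\<close>

lemma trels_finite_support:
  assumes "z \<in> zspan (trels s UNIV)"
  shows "\<exists>F. finite F \<and> (\<forall>Q. F \<subseteq> Q \<longrightarrow> z \<in> zspan (trels s Q))"
  using assms
proof induction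
  case zspan_zero
  then show ?case by (auto intro: zspan.zspan_zero)
next
  case (zspan_base x)
  then show ?case
  proof (cases rule: trels_cases)
    case (addl m m' h)
    then show ?thesis by (intro exI[of _ "{m, m'}"]) (auto intro: trels_addl)
  next
    case (addr m h h')
    then show ?thesis by (intro exI[of _ "{m}"]) (auto intro: trels_addr)
  next
    case (act m a h)
    then show ?thesis by (intro exI[of _ "{m}"]) (auto intro: trels_act)
  next
    case (R r h)
    then show ?thesis by (intro exI[of _ "{}"]) (auto intro: trels_R)
  qed
next
  case (zspan_diff x y)
  then obtain F G where "finite F" "\<forall>Q. F \<subseteq> Q \<longrightarrow> x \<in> zspan (trels s Q)"
    "finite G" "\<forall>Q. G \<subseteq> Q \<longrightarrow> y \<in> zspan (trels s Q)" by blast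
  then show ?case by (intro exI[of _ "F \<union> G"]) (auto intro: zspan.zspan_diff)
qed

lemma trels_diff2:
  assumes "x - y - z \<in> R"
  shows "frag_of (x, h) - frag_of (y, h) - frag_of (z, h) \<in> zspan (trels s UNIV)"
proof -
  have U: "submod UNIV" by (simp add: submod_def)
  have 1: "frag_of (x - y - z, h) - (frag_of (x - y, h) - frag_of (z, h)) \<in> zspan (trels s UNIV)"
    and 2: "frag_of (x - y, h) - (frag_of (x, h) - frag_of (y, h)) \<in> zspan (trels s UNIV)"
    using U by (intro trels_diffl; simp)+
  from zspan_diff[OF zspan_diff[OF trels_R[OF assms, of h] 1] 2] show ?thesis
    by (simp add: algebra_simps)
qed

lemma trels_additive:
  "frag_of (fsum_eval z g, h) - frag_extend (\<lambda>k. frag_of (g k, h)) z \<in> zspan (trels s UNIV)"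
  using additive_mod_fsum_eval[of "\<lambda>m. frag_of (m, h)"] trels_addl by blast

text \<open>Injectivity of \<open>P \<otimes> \<H> \<rightarrow> Q \<otimes> \<H>\<close> for the submodule \<open>Q = P + n A\<close>: it is the pushout of
  \<open>\<aa> \<otimes> \<H> \<rightarrow> A \<otimes> \<H>\<close> along \<open>a \<mapsto> n a\<close>, where \<open>\<aa> = {a. n a \<in> P}\<close>. The pair \<open>(\<Phi>, \<Psi>)\<close>
  below maps \<open>Q \<otimes> \<H>\<close> into that pushout of \<open>P \<otimes> \<H>\<close> and \<open>\<H> = A \<otimes> \<H>\<close>.\<close>

lemma flat_step:
  fixes s :: "'a \<Rightarrow> 'h::{ring,monoid_mult}"
  assumes flat: "flat_s s" and inj: "inj s"
    and s_add: "\<And>a b. s (a + b) = s a + s b"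
    and s_mult: "\<And>a b. s (a * b) = s a * s b" and s_1: "s 1 = 1"
    and P: "submod P"
  obtains Q where "submod Q" "P \<subseteq> Q" "n \<in> Q"
    "\<And>z. Poly_Mapping.keys z \<subseteq> P \<times> UNIV \<Longrightarrow> z \<in> zspan (trels s Q) \<Longrightarrow> z \<in> zspan (trels s P)"
proof -
  define Q where "Q = {q. \<exists>a. q - act n a \<in> P}"
  define \<aa> where "\<aa> = {a. act n a \<in> P}"
  note P' = submodD[OF P]
  have s_diff: "s (a - b) = s a - s b" for a b
    using s_add[of "a - b" b] by (simp add: algebra_simps)
  have PQ: "P \<subseteq> Q"
    unfolding Q_def using act_0_right[of n] P'(1,2) by blast
  have ideal_0: "0 \<in> \<aa>" unfolding \<aa>_def using act_0_right P'(1) by blast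
  have ideal_diff: "a - b \<in> \<aa>" if "a \<in> \<aa>" "b \<in> \<aa>" for a b
    using that P'(2) submod_cong[OF P act_diff_right] unfolding \<aa>_def by blast
  have ideal_mult: "a * b \<in> \<aa>" if "a \<in> \<aa>" for a b
    using that P'(3) unfolding \<aa>_def by (simp add: act_mult)
  have "submod Q"
    unfolding submod_def
  proof (intro conjI ballI allI)
    show "R \<subseteq> Q" using PQ P'(1) by blast
    fix x assume "x \<in> Q"
    then obtain a where a: "x - act n a \<in> P" by (auto simp: Q_def)
    have "act x b - act n (a * b) \<in> P" for b
      using P'(3)[OF a, of b] by (simp add: act_mult act_diff)
    then show "act x b \<in> Q" for b by (auto simp: Q_def)
    fix y assume "y \<in> Q"
    then obtain b where b: "y - act n b \<in> P" by (auto simp: Q_def)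
    have "(x - act n a) - (y - act n b) - (act n (a - b) - (act n a - act n b)) \<in> P"
      by (intro P'(2)[OF P'(2)[OF a b] P'(1)[OF act_diff_right]])
    then have "x - y - act n (a - b) \<in> P" by (simp add: algebra_simps)
    then show "x - y \<in> Q" by (auto simp: Q_def)
  qed
  have n: "n \<in> Q"
    unfolding Q_def using act_1[of n] P'(4) by (auto intro!: exI[of _ 1])
  \<comment> \<open>For \<open>q\<close> in \<open>Q\<close>, \<open>c q\<close> is a coefficient
    with \<open>q = n (c q)\<close> modulo \<open>P\<close>. The value \<open>0\<close> on
    \<open>P\<close> ensures that on \<open>P \<otimes> \<H>\<close> the map \<open>\<Psi>\<close>
    vanishes and \<open>\<Phi>\<close> is the identity modulo relations.\<close>
  define c where "c q = (if q \<in> P then 0 else SOME a. q - act n a \<in> P)" for q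
  define p where "p q = q - act n (c q)" for q
  have p: "p q \<in> P" if "q \<in> Q" for q
  proof (cases "q \<in> P")
    case True
    then show ?thesis using act_0_right[of n] P'(1,2) by (auto simp: p_def c_def)
  next
    case False
    then show ?thesis using that someI_ex[of "\<lambda>a. q - act n a \<in> P"]
      by (auto simp: Q_def p_def c_def)
  qed
  define \<Phi> where "\<Phi> = frag_extend (\<lambda>(q, h). frag_of (p q, h :: 'h))"
  define \<Psi> where "\<Psi> w = fsum_eval w (\<lambda>(q, h). s (c q) * h)" for w
  define N where "N = frag_extend (\<lambda>(a, h). frag_of (act n a, h :: 'h))"
  define ev where "ev u = fsum_eval u (\<lambda>(a, h). s a * h)" for u
  let ?T = "zspan (trels s P)"
  \<comment> \<open>Vanishing in the pushout: the pair \<open>(\<Phi> w, \<Psi> w)\<close> is the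
    image \<open>(N u, - ev u)\<close> of some \<open>u\<close> in
    \<open>\<aa> \<otimes> \<H>\<close>.\<close>
  define good where "good w \<longleftrightarrow> (\<exists>u. Poly_Mapping.keys u \<subseteq> \<aa> \<times> UNIV \<and> \<Phi> w - N u \<in> ?T \<and> \<Psi> w = - ev u)" for w
  have good_diff: "good (x - y)" if "good x" "good y" for x y
  proof -
    from that obtain u v where u: "Poly_Mapping.keys u \<subseteq> \<aa> \<times> UNIV" "\<Phi> x - N u \<in> ?T" "\<Psi> x = - ev u"
      and v: "Poly_Mapping.keys v \<subseteq> \<aa> \<times> UNIV" "\<Phi> y - N v \<in> ?T" "\<Psi> y = - ev v"
      unfolding good_def by blast
    have "Poly_Mapping.keys (u - v) \<subseteq> \<aa> \<times> UNIV"
      using u v Poly_Mapping.keys_diff by fast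
    moreover have "\<Phi> (x - y) - N (u - v) \<in> ?T"
      using zspan_diff[OF u(2) v(2)]
      by (simp add: \<Phi>_def N_def frag_extend_diff algebra_simps)
    moreover have "\<Psi> (x - y) = - ev (u - v)"
      using u v by (simp add: \<Psi>_def ev_def fsum_eval_diff)
    ultimately show ?thesis unfolding good_def by blast
  qed
  have good_single: "good w"
    if "d \<in> \<aa>" "\<Phi> w + frag_of (act n d, h) \<in> ?T" "\<Psi> w = s d * h" for w d h
    unfolding good_def using that
    by (intro exI[of _ "- frag_of (d, h)"])
       (auto simp: N_def ev_def frag_extend_minus fsum_eval_uminus)
  have good_zspan: "good w" if "w \<in> zspan (trels s Q)" for w
    using that
  proof induction
    case zspan_zero
    then show ?case unfolding good_def
      by (intro exI[of _ 0]) (auto simp: \<Phi>_def N_def \<Psi>_def ev_def intro: zspan.zspan_zero)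
  next
    case (zspan_diff x y)
    then show ?case by (intro good_diff)
  next
    case (zspan_base x)
    then show ?case
    proof (cases rule: trels_cases)
      case (addl m m' h)
      \<comment> \<open>\<open>d\<close> measures the failure of \<open>c\<close> to be additive.
        Modulo \<open>R\<close>, \<open>n d\<close> is a combination of values of \<open>p\<close>,
        which lie in \<open>P\<close>; hence \<open>d \<in> \<aa>\<close>.\<close>
      define d where "d = c (m + m') - c m - c m'"
      have mm: "m + m' \<in> Q" using addl \<open>submod Q\<close> by (auto intro: submodD)
      define r where "r = (p m + p m' - p (m + m')) - act n d"
      have "- (act n (c (m + m') - c m - c m') - (act n (c (m + m') - c m) - act n (c m')))
          - (act n (c (m + m') - c m) - (act n (c (m + m')) - act n (c m))) \<in> R"
        by (intro R_diff R_uminus act_diff_right)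
      then have r: "r \<in> R" unfolding r_def p_def d_def by (simp add: algebra_simps)
      have pp: "p m + p m' - p (m + m') \<in> P" using addl mm p by (intro P'(2,6)) auto
      have d: "d \<in> \<aa>"
        using pp submod_cong[OF P, of "p m + p m' - p (m + m')" "act n d"] r
        unfolding \<aa>_def r_def by simp
      then have nd: "act n d \<in> P" by (simp add: \<aa>_def)
      have 1: "frag_of (p m + p m' - p (m + m'), h) - frag_of (act n d, h) \<in> ?T"
        using nd r by (intro trels_cong P) (auto simp: r_def)
      have 2: "frag_of (p m + p m' - p (m + m'), h)
          - (frag_of (p m + p m', h) - frag_of (p (m + m'), h)) \<in> ?T"
        using addl mm p by (intro trels_diffl P P'(6)) auto
      have 3: "frag_of (p m + p m', h) - frag_of (p m, h) - frag_of (p m', h) \<in> ?T"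
        using addl p by (intro trels_addl) auto
      from zspan_add[OF zspan.zspan_diff[OF 2 1] 3]
      have "\<Phi> x + frag_of (act n d, h) \<in> ?T"
        by (simp add: \<Phi>_def addl frag_extend_diff frag_extend_add algebra_simps)
      then show ?thesis
        by (rule good_single[OF d])
           (simp add: addl \<Psi>_def fsum_eval_diff fsum_eval_add d_def s_diff s_add algebra_simps)
    next
      case (addr m h h')
      have "\<Phi> x \<in> ?T"
        using trels_addr[OF p, of m h h' s] addr(1)
        by (simp add: addr(2) \<Phi>_def frag_extend_diff)
      then have "\<Phi> x + frag_of (act n 0, 0) \<in> ?T"
        by (intro zspan_add trels_R act_0_right)
      then show ?thesis
        by (rule good_single[OF ideal_0])
           (simp add: addr(2) \<Psi>_def fsum_eval_diff fsum_eval_add algebra_simps)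
    next
      case (act m a h)
      \<comment> \<open>Here \<open>d\<close> measures the failure of \<open>c\<close> to commute
        with scalars; \<open>n d\<close> agrees modulo \<open>R\<close> with an element of
        \<open>P\<close> as before.\<close>
      define d where "d = c (act m a) - c m * a"
      have ma: "act m a \<in> Q" using act \<open>submod Q\<close> by (auto intro: submodD)
      define r where "r = (act (p m) a - p (act m a)) - act n d"
      have r: "r \<in> R"
        using R_uminus[OF act_diff_right[of n "c (act m a)" "c m * a"]]
        by (simp add: r_def p_def d_def act_diff act_mult algebra_simps)
      have pa: "act (p m) a \<in> P" using act p by (intro P'(3)) auto
      have "act (p m) a - p (act m a) \<in> P" using pa ma p by (intro P'(2)) auto
      then have d: "d \<in> \<aa>"
        using submod_cong[OF P, of "act (p m) a - p (act m a)" "act n d"] r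
        unfolding \<aa>_def r_def by simp
      then have nd: "act n d \<in> P" by (simp add: \<aa>_def)
      have 1: "frag_of (act (p m) a - p (act m a), h) - frag_of (act n d, h) \<in> ?T"
        using nd r by (intro trels_cong P) (auto simp: r_def)
      have 2: "frag_of (act (p m) a - p (act m a), h)
          - (frag_of (act (p m) a, h) - frag_of (p (act m a), h)) \<in> ?T"
        using pa ma p by (intro trels_diffl P) auto
      have 3: "frag_of (act (p m) a, h) - frag_of (p m, s a * h) \<in> ?T"
        using act p by (intro trels_act) auto
      from zspan_add[OF zspan.zspan_diff[OF 2 1] 3]
      have "\<Phi> x + frag_of (act n d, h) \<in> ?T"
        by (simp add: \<Phi>_def act frag_extend_diff frag_extend_add algebra_simps)
      then show ?thesis
        by (rule good_single[OF d])
           (simp add: act \<Psi>_def fsum_eval_diff fsum_eval_add d_def s_diff s_mult algebra_simps)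
    next
      case (R r h)
      have "c r = 0" using R P'(1) by (simp add: c_def)
      then have "p r \<in> R" using R act_0_right R_diff by (simp add: p_def)
      from zspan_add[OF trels_R[OF this] trels_R[OF act_0_right]]
      have "\<Phi> x + frag_of (act n 0, h) \<in> ?T"
        by (simp add: \<Phi>_def R)
      then show ?thesis
        by (rule good_single[OF ideal_0]) (simp add: R \<Psi>_def \<open>c r = 0\<close>)
    qed
  qed
  show ?thesis
  proof (rule that[of Q])
    fix z :: "('g \<times> 'h) \<Rightarrow>\<^sub>0 int"
    assume keys: "Poly_Mapping.keys z \<subseteq> P \<times> UNIV" and z: "z \<in> zspan (trels s Q)"
    obtain u where u: "Poly_Mapping.keys u \<subseteq> \<aa> \<times> UNIV" "\<Phi> z - N u \<in> ?T" "\<Psi> z = - ev u"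
      using good_zspan[OF z] unfolding good_def by blast
    have s_0: "s 0 = 0" using s_add[of 0 0] by simp
    \<comment> \<open>Since \<open>c\<close> vanishes on \<open>P\<close>, also
      \<open>ev u = 0\<close>. The right ideal test gives \<open>u = 0\<close> in
      \<open>\<aa> \<otimes> \<H>\<close>, so \<open>N u\<close> vanishes, and with it
      \<open>\<Phi> z\<close>, which is \<open>z\<close> modulo relations.\<close>
    have "\<Psi> z = 0"
      unfolding \<Psi>_def fsum_eval_def using keys
      by (intro sum.neutral) (auto simp: c_def s_0 zmul_def)
    with u have "u \<in> zspan (tensor_rels \<aa> (+) (*) UNIV (+) (\<lambda>a h. s a * h))"
      by (intro flat_s_right_ideal flat inj s_add s_mult s_1 ideal_0 ideal_diff ideal_mult)
         (auto simp: ev_def)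
    then have "N u \<in> ?T"
      unfolding N_def
    proof (rule zspan_frag_map)
      fix x assume "x \<in> tensor_rels \<aa> (+) (*) UNIV (+) (\<lambda>a h. s a * h)"
      then show "frag_extend (\<lambda>(a, h). frag_of (act n a, h)) x \<in> ?T"
      proof (cases rule: tensor_rels_cases)
        case (addl a b h)
        have "act n a \<in> P" "act n b \<in> P" using addl by (auto simp: \<aa>_def)
        then have 1: "frag_of (act n (a + b), h) - frag_of (act n a + act n b, h) \<in> ?T"
          and 2: "frag_of (act n a + act n b, h) - frag_of (act n a, h) - frag_of (act n b, h) \<in> ?T"
          using act_distrib[of n a b]
          by (simp_all add: diff_diff_eq trels_cong[OF P P'(6)] trels_addl[unfolded diff_diff_eq])
        from zspan_add[OF 1 2] show ?thesis by (simp add: addl frag_extend_diff frag_extend_add algebra_simps)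
      next
        case (addr a h h')
        then show ?thesis using trels_addr by (auto simp: \<aa>_def frag_extend_diff)
      next
        case (act a b h)
        then show ?thesis using trels_act by (auto simp: \<aa>_def frag_extend_diff act_mult)
      qed
    qed
    moreover have "\<Phi> z - frag_extend frag_of z \<in> ?T"
      unfolding \<Phi>_def
    proof (rule frag_extend_cong_zspan, clarify)
      fix q h assume "(q, h) \<in> Poly_Mapping.keys z"
      then have "q \<in> P" using keys by auto
      moreover from this have "p q - q \<in> R" using R_uminus[OF act_0_right] by (simp add: p_def c_def)
      ultimately show "frag_of (p q, h) - frag_of (q, h) \<in> ?T" by (intro trels_cong P)
    qed
    ultimately show "z \<in> ?T"
      using u(2) zspan_cong by (metis frag_extend_of_id)
  qed (use \<open>submod Q\<close> PQ n in auto)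
qed

text \<open>Iterates \<open>flat_step\<close> over the elements of \<open>F\<close>; the injections
  \<open>P \<otimes> \<H> \<rightarrow> Q \<otimes> \<H> \<rightarrow> Q' \<otimes> \<H>\<close>
  compose.\<close>

lemma flat_extend:
  fixes s :: "'a \<Rightarrow> 'h::{ring,monoid_mult}"
  assumes flat: "flat_s s" "inj s"
    "\<And>a b. s (a + b) = s a + s b" "\<And>a b. s (a * b) = s a * s b" "s 1 = 1"
    and P: "submod P" and F: "finite F"
  shows "\<exists>Q. submod Q \<and> P \<subseteq> Q \<and> F \<subseteq> Q \<and>
    (\<forall>z. Poly_Mapping.keys z \<subseteq> P \<times> UNIV \<longrightarrow> z \<in> zspan (trels s Q) \<longrightarrow> z \<in> zspan (trels s P))"
  using F
proof induction
  case empty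
  then show ?case using P by (intro exI[of _ P]) simp
next
  case (insert n F)
  then obtain Q where Q: "submod Q" "P \<subseteq> Q" "F \<subseteq> Q"
    and PQ: "\<And>z. Poly_Mapping.keys z \<subseteq> P \<times> UNIV \<Longrightarrow> z \<in> zspan (trels s Q) \<Longrightarrow> z \<in> zspan (trels s P)"
    by auto
  obtain Q' where Q': "submod Q'" "Q \<subseteq> Q'" "n \<in> Q'"
    and QQ': "\<And>z. Poly_Mapping.keys z \<subseteq> Q \<times> UNIV \<Longrightarrow> z \<in> zspan (trels s Q') \<Longrightarrow> z \<in> zspan (trels s Q)"
    using flat_step[OF flat Q(1), of n] by metis
  have "z \<in> zspan (trels s P)" if "Poly_Mapping.keys z \<subseteq> P \<times> UNIV" "z \<in> zspan (trels s Q')" for z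
    using that Q(2) by (intro PQ QQ') auto
  moreover have "P \<subseteq> Q'" "insert n F \<subseteq> Q'" using Q Q' by auto
  ultimately show ?case using Q'(1) by (intro exI[of _ Q'] conjI) auto
qed

text \<open>Flatness for modules over an arbitrary carrier type: a derivation of
  \<open>z = 0\<close> over the whole module already takes place over some \<open>Q\<close> obtained
  from \<open>P\<close> by adjoining finitely many generators.\<close>

lemma flat_injective:
  fixes s :: "'a \<Rightarrow> 'h::{ring,monoid_mult}"
  assumes "flat_s s" "inj s"
    "\<And>a b. s (a + b) = s a + s b" "\<And>a b. s (a * b) = s a * s b" "s 1 = 1"
    and "submod P" "Poly_Mapping.keys z \<subseteq> P \<times> UNIV" "z \<in> zspan (trels s UNIV)"
  shows "z \<in> zspan (trels s P)"
proof -
  obtain F where F: "finite F" "\<And>Q. F \<subseteq> Q \<Longrightarrow> z \<in> zspan (trels s Q)"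
    using trels_finite_support[OF assms(8)] by metis
  obtain Q where "F \<subseteq> Q" "Poly_Mapping.keys z \<subseteq> P \<times> UNIV \<Longrightarrow> z \<in> zspan (trels s Q) \<Longrightarrow> z \<in> zspan (trels s P)"
    using flat_extend[OF assms(1-6) F(1)] by metis
  with F(2) assms(7) show ?thesis by blast
qed

end

section \<open>Left ideals and coinvariants\<close>

definition left_ideal :: "'h::ring set \<Rightarrow> bool" where
  "left_ideal I \<longleftrightarrow> 0 \<in> I \<and> (\<forall>x\<in>I. \<forall>y\<in>I. x - y \<in> I) \<and> (\<forall>h. \<forall>x\<in>I. h * x \<in> I)"

lemma left_idealD:
  assumes "left_ideal I"
  shows "0 \<in> I" "x \<in> I \<Longrightarrow> y \<in> I \<Longrightarrow> x - y \<in> I" "x \<in> I \<Longrightarrow> h * x \<in> I"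
    "x \<in> I \<Longrightarrow> - x \<in> I" "x \<in> I \<Longrightarrow> y \<in> I \<Longrightarrow> x + y \<in> I"
proof -
  show z: "0 \<in> I" and d: "x \<in> I \<Longrightarrow> y \<in> I \<Longrightarrow> x - y \<in> I" and "x \<in> I \<Longrightarrow> h * x \<in> I" for x y h
    using assms unfolding left_ideal_def by blast+
  show u: "x \<in> I \<Longrightarrow> - x \<in> I" for x using d[OF z] by fastforce
  show "x \<in> I \<Longrightarrow> y \<in> I \<Longrightarrow> x + y \<in> I" using d[OF _ u] by fastforce
qed

lemma left_ideal_lmul_span: "left_ideal (lmul_span S)"
  unfolding left_ideal_def
proof (intro conjI ballI allI)
  show "0 \<in> lmul_span S" unfolding lmul_span_def by (auto intro!: exI[of _ "[]"])
  fix x assume "x \<in> lmul_span S"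
  then obtain l where l: "x = sum_list (map (\<lambda>(h, b). h * b) l)" "\<forall>p\<in>set l. snd p \<in> S"
    unfolding lmul_span_def by blast
  have "h * x = sum_list (map (\<lambda>(h, b). h * b) (map (\<lambda>(g, b). (h * g, b)) l))" for h
    unfolding l(1) by (induction l) (auto simp: algebra_simps)
  moreover have "\<forall>p\<in>set (map (\<lambda>(g, b). (h * g, b)) l). snd p \<in> S" for h
    using l(2) by auto
  ultimately show "h * x \<in> lmul_span S" for h unfolding lmul_span_def by blast
  fix y assume "y \<in> lmul_span S"
  then obtain m where m: "y = sum_list (map (\<lambda>(h, b). h * b) m)" "\<forall>p\<in>set m. snd p \<in> S"
    unfolding lmul_span_def by blast
  have "- y = sum_list (map (\<lambda>(h, b). h * b) (map (\<lambda>(g, b). (- g, b)) m))"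
    unfolding m(1) by (induction m) auto
  then have "x - y = sum_list (map (\<lambda>(h, b). h * b) (l @ map (\<lambda>(g, b). (- g, b)) m))"
    using l(1) by (metis add_uminus_conv_diff map_append sum_list_append)
  moreover have "\<forall>p\<in>set (l @ map (\<lambda>(g, b). (- g, b)) m). snd p \<in> S"
    using l(2) m(2) by auto
  ultimately show "x - y \<in> lmul_span S" unfolding lmul_span_def by blast
qed

lemma lmul_span_superset: "S \<subseteq> lmul_span S"
proof
  fix x assume "x \<in> S"
  then show "x \<in> lmul_span S"
    unfolding lmul_span_def by (auto intro!: exI[of _ "[(1, x)]"])
qed

lemma lmul_span_least: "S \<subseteq> I \<Longrightarrow> left_ideal I \<Longrightarrow> lmul_span S \<subseteq> I"
proof
  fix x assume S: "S \<subseteq> I" and I: "left_ideal I" and "x \<in> lmul_span S"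
  then obtain l where l: "x = sum_list (map (\<lambda>(h, b). h * b) l)" "\<forall>p\<in>set l. snd p \<in> S"
    unfolding lmul_span_def by blast
  have "\<forall>p\<in>set l. snd p \<in> S \<Longrightarrow> sum_list (map (\<lambda>(h, b). h * b) l) \<in> I"
    using S by (induction l) (auto intro!: left_idealD(1,3,5)[OF I])
  with l show "x \<in> I" by simp
qed

section \<open>Left bialgebroids\<close>

locale bialgebroid =
  fixes smA :: "'k::field \<Rightarrow> 'a::{ring,monoid_mult} \<Rightarrow> 'a"
    and smH :: "'k \<Rightarrow> 'h::{ring,monoid_mult} \<Rightarrow> 'h"
    and s t :: "'a \<Rightarrow> 'h"
    and D :: "'h \<Rightarrow> ('h \<times> 'h) \<Rightarrow>\<^sub>0 int"
    and eps :: "'h \<Rightarrow> 'a"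
  assumes bialg: "left_bialgebroid smA smH s t D eps"
begin

section \<open>Consequences of the bialgebroid axioms\<close>

lemma s_add: "s (a + b) = s a + s b" and s_mult: "s (a * b) = s a * s b" and s_1: "s 1 = 1"
  and t_add: "t (a + b) = t a + t b" and t_mult: "t (a * b) = t b * t a" and t_1: "t 1 = 1"
  and st_commute: "s a * t b = t b * s a"
  and D_add: "D (x + y) - (D x + D y) \<in> zspan (HH_rels s t UNIV)"
  and eps_add: "eps (x + y) = eps x + eps y"
  and counit_left: "fsum_eval (D h) (\<lambda>(x, y). s (eps x) * y) = h"
  and counit_right: "fsum_eval (D h) (\<lambda>(x, y). t (eps y) * x) = h"
  and eps_1: "eps 1 = 1"
  using bialg unfolding left_bialgebroid_def by simp_all

lemma coassoc:
  "frag_extend (\<lambda>(x, y). frag_extend (\<lambda>(u, v). frag_of (u, v, y)) (D x)) (D h)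
    - frag_extend (\<lambda>(x, y). frag_extend (\<lambda>(u, v). frag_of (x, u, v)) (D y)) (D h)
    \<in> zspan (H3_rels s t UNIV)"
  using bialg unfolding left_bialgebroid_def by blast

lemma D_bilinear:
  "D (s a * t b * h) - frag_extend (\<lambda>(x, y). frag_of (s a * x, t b * y)) (D h) \<in> zspan (HH_rels s t UNIV)"
  using bialg unfolding left_bialgebroid_def by blast

lemma eps_bilinear: "eps (s a * t b * h) = a * eps h * b"
  using bialg unfolding left_bialgebroid_def by blast

lemma D_1: "D 1 - frag_of (1, 1) \<in> zspan (HH_rels s t UNIV)"
  using bialg unfolding left_bialgebroid_def by blast

lemma D_s: "D (s a * h) - frag_extend (\<lambda>(x, y). frag_of (s a * x, y)) (D h) \<in> zspan (HH_rels s t UNIV)"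
  using D_bilinear[of a 1 h] by (simp add: t_1)

lemma D_t: "D (t b * h) - frag_extend (\<lambda>(x, y). frag_of (x, t b * y)) (D h) \<in> zspan (HH_rels s t UNIV)"
  using D_bilinear[of 1 b h] by (simp add: s_1)

lemma eps_s: "eps (s a * h) = a * eps h"
  using eps_bilinear[of a 1 h] by (simp add: t_1)

lemma eps_t: "eps (t b * h) = eps h * b"
  using eps_bilinear[of 1 b h] by (simp add: s_1)

lemma eps_diff: "eps (x - y) = eps x - eps y"
  using eps_add[of "x - y" y] by (simp add: algebra_simps)

text \<open>\<open>eps\<close> provides a left inverse of \<open>s\<close>: by linearity
  \<open>eps (s a * 1) = a * eps 1 = a\<close>.\<close>

lemma inj_s: "inj s"
proof (rule injI)
  fix a b assume "s a = s b"
  then have "eps (s a * 1) = eps (s b * 1)" by simp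
  then show "a = b" unfolding eps_s eps_1 by simp
qed

text \<open>Presents \<open>\<H>/I \<otimes> \<H>\<close> on pairs of elements of
  \<open>\<H>\<close>. Any set may stand for \<open>I\<close>: \<open>{}\<close> gives
  \<open>\<H> \<otimes> \<H>\<close>, and the set of coinvariants expresses that an element comes
  from coinvariants tensored with \<open>\<H>\<close>.\<close>

definition quot_rels :: "'h set \<Rightarrow> (('h \<times> 'h) \<Rightarrow>\<^sub>0 int) set" where
  "quot_rels I = HH_rels s t UNIV \<union> {frag_of (u, v) | u v. u \<in> I}"

lemma quot_rels_empty: "quot_rels {} = HH_rels s t UNIV"
  by (simp add: quot_rels_def)

lemma zspan_HH: "z \<in> zspan (HH_rels s t UNIV) \<Longrightarrow> z \<in> zspan (quot_rels I)"
  by (erule zspan_mono) (auto simp: quot_rels_def)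

lemma quot_addl: "frag_of (x + x', y) - frag_of (x, y) - frag_of (x', y) \<in> zspan (quot_rels I)"
  unfolding quot_rels_def HH_rels_def by (intro zspan_base UnI1 tensor_rels_addl) auto

lemma quot_addr: "frag_of (x, y + y') - frag_of (x, y) - frag_of (x, y') \<in> zspan (quot_rels I)"
  unfolding quot_rels_def HH_rels_def by (intro zspan_base UnI1 tensor_rels_addr) auto

lemma quot_act: "frag_of (t a * x, y) - frag_of (x, s a * y) \<in> zspan (quot_rels I)"
  unfolding quot_rels_def HH_rels_def
  by (intro zspan_base UnI1 tensor_rels_act[where actM = "\<lambda>x a. t a * x"]) auto

lemma quot_I: "u \<in> I \<Longrightarrow> frag_of (u, v) \<in> zspan (quot_rels I)"
  unfolding quot_rels_def by (rule zspan_base) blast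

lemma quot_cong:
  assumes "u - u' \<in> I"
  shows "frag_of (u, v) - frag_of (u', v) \<in> zspan (quot_rels I)"
  using zspan_add[OF quot_addl[of "u - u'" u' v] quot_I[OF assms, of v]] by simp

lemma quot_rels_cases [consumes 1, case_names addl addr act I]:
  assumes "z \<in> quot_rels I"
  obtains x x' y where "z = frag_of (x + x', y) - frag_of (x, y) - frag_of (x', y)"
  | x y y' where "z = frag_of (x, y + y') - frag_of (x, y) - frag_of (x, y')"
  | a x y where "z = frag_of (t a * x, y) - frag_of (x, s a * y)"
  | u v where "u \<in> I" "z = frag_of (u, v)"
  using assms unfolding quot_rels_def HH_rels_def by (blast elim: tensor_rels_cases)

text \<open>Right exactness: what dies in \<open>\<H>/I \<otimes> \<H>\<close> comes from
  \<open>I \<otimes> \<H>\<close>. The pairs with left entry in \<open>I\<close> used by the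
  derivation are collected in \<open>w\<close>.\<close>

lemma zspan_quot_rels_decompose:
  assumes "z \<in> zspan (quot_rels I)"
  shows "\<exists>w. Poly_Mapping.keys w \<subseteq> I \<times> UNIV \<and> z - w \<in> zspan (HH_rels s t UNIV)"
  using assms
proof induction
  case zspan_zero
  then show ?case by (intro exI[of _ 0]) (auto intro: zspan.zspan_zero)
next
  case (zspan_base x)
  then consider "x \<in> HH_rels s t UNIV" | u v where "u \<in> I" "x = frag_of (u, v)"
    unfolding quot_rels_def by blast
  then show ?case
  proof cases
    case 1
    then show ?thesis by (intro exI[of _ 0]) (auto intro: zspan.zspan_base)
  next
    case 2
    then show ?thesis by (intro exI[of _ x]) (auto intro: zspan.zspan_zero)
  qed
next
  case (zspan_diff x y)
  then obtain v w where v: "Poly_Mapping.keys v \<subseteq> I \<times> UNIV" "x - v \<in> zspan (HH_rels s t UNIV)"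
    and w: "Poly_Mapping.keys w \<subseteq> I \<times> UNIV" "y - w \<in> zspan (HH_rels s t UNIV)" by blast
  have "Poly_Mapping.keys (v - w) \<subseteq> I \<times> UNIV" using v(1) w(1) Poly_Mapping.keys_diff by fast
  moreover have "x - y - (v - w) \<in> zspan (HH_rels s t UNIV)"
    using zspan.zspan_diff[OF v(2) w(2)] by (simp add: algebra_simps)
  ultimately show ?case by blast
qed

lemma qcls_eq_iff: "left_ideal I \<Longrightarrow> qcls I x = qcls I y \<longleftrightarrow> x - y \<in> I"
proof
  assume I: "left_ideal I"
  have "x \<in> qcls I x" using left_idealD(1)[OF I] by (simp add: qcls_def)
  then show "qcls I x = qcls I y \<Longrightarrow> x - y \<in> I" unfolding qcls_def by blast
  show "qcls I x = qcls I y" if "x - y \<in> I"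
  proof -
    have "z - x \<in> I \<longleftrightarrow> z - y \<in> I" for z
      using left_idealD(5)[OF I, of "z - x" "x - y"] left_idealD(2)[OF I, of "z - y" "x - y"] that
      by auto
    then show ?thesis by (simp add: qcls_def)
  qed
qed

lemma qadd_qcls: "left_ideal I \<Longrightarrow> qadd I (qcls I x) (qcls I y) = qcls I (x + y)"
proof -
  assume I: "left_ideal I"
  have "z \<in> qadd I (qcls I x) (qcls I y) \<longleftrightarrow> z \<in> qcls I (x + y)" for z
  proof
    assume "z \<in> qadd I (qcls I x) (qcls I y)"
    then obtain c e where "c - x \<in> I" "e - y \<in> I" "z - (c + e) \<in> I"
      by (auto simp: qadd_def qcls_def)
    then have "z - (c + e) + ((c - x) + (e - y)) \<in> I" by (intro left_idealD(5)[OF I])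
    then show "z \<in> qcls I (x + y)" by (simp add: qcls_def algebra_simps)
  next
    assume "z \<in> qcls I (x + y)"
    then show "z \<in> qadd I (qcls I x) (qcls I y)"
      using left_idealD(1)[OF I] unfolding qadd_def qcls_def
      by (intro CollectI bexI[of _ x] bexI[of _ y]) auto
  qed
  then show ?thesis by blast
qed

lemma qact_qcls: "left_ideal I \<Longrightarrow> qact t I (qcls I x) a = qcls I (t a * x)"
proof -
  assume I: "left_ideal I"
  have "z \<in> qact t I (qcls I x) a \<longleftrightarrow> z \<in> qcls I (t a * x)" for z
  proof
    assume "z \<in> qact t I (qcls I x) a"
    then obtain c where "c - x \<in> I" "z - t a * c \<in> I"
      by (auto simp: qact_def qcls_def)
    then have "z - t a * c + t a * (c - x) \<in> I" by (intro left_idealD(3,5)[OF I])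
    then show "z \<in> qcls I (t a * x)" by (simp add: qcls_def algebra_simps)
  next
    assume "z \<in> qcls I (t a * x)"
    then show "z \<in> qact t I (qcls I x) a"
      using left_idealD(1)[OF I] by (auto simp: qact_def qcls_def intro!: exI[of _ x])
  qed
  then show ?thesis by blast
qed

text \<open>\<open>\<H>/I \<otimes> \<H>\<close> is presented on \<open>\<H> \<times> \<H>\<close> instead of \<open>\<H>/I \<times> \<H>\<close>.\<close>

lemma zspan_qcls_iff:
  assumes I: "left_ideal I"
  shows "frag_extend (\<lambda>(u, v). frag_of (qcls I u, v)) z
      \<in> zspan (tensor_rels (range (qcls I)) (qadd I) (qact t I) UNIV (+) (\<lambda>a y. s a * y))
    \<longleftrightarrow> z \<in> zspan (quot_rels I)" (is "?\<pi> z \<in> zspan ?T \<longleftrightarrow> _")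
proof
  assume "z \<in> zspan (quot_rels I)"
  then show "?\<pi> z \<in> zspan ?T"
  proof (rule zspan_frag_map)
    fix w assume "w \<in> quot_rels I"
    then show "?\<pi> w \<in> zspan ?T"
    proof (cases rule: quot_rels_cases)
      case (addl x x' y)
      have "frag_of (qadd I (qcls I x) (qcls I x'), y) - frag_of (qcls I x, y) - frag_of (qcls I x', y) \<in> ?T"
        by (intro tensor_rels_addl) auto
      then show ?thesis by (intro zspan_base) (simp add: addl qadd_qcls[OF I] frag_extend_diff)
    next
      case (addr x y y')
      have "frag_of (qcls I x, y + y') - frag_of (qcls I x, y) - frag_of (qcls I x, y') \<in> ?T"
        by (intro tensor_rels_addr) auto
      then show ?thesis by (intro zspan_base) (simp add: addr frag_extend_diff)
    next
      case (act a x y)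
      have "frag_of (qact t I (qcls I x) a, y) - frag_of (qcls I x, s a * y) \<in> ?T"
        by (intro tensor_rels_act) auto
      then show ?thesis by (intro zspan_base) (simp add: act qact_qcls[OF I] frag_extend_diff)
    next
      case (I u v)
      have 0: "qcls I u = qcls I 0" using I(1) by (simp add: qcls_eq_iff[OF assms])
      \<comment> \<open>As \<open>0 + 0 = 0\<close> in \<open>\<H>/I\<close>, this additivity
        relation is just \<open>- (0 \<otimes> v)\<close>.\<close>
      have "frag_of (qadd I (qcls I 0) (qcls I 0), v) - frag_of (qcls I 0, v) - frag_of (qcls I 0, v) \<in> ?T"
        by (intro tensor_rels_addl) auto
      then have "- frag_of (qcls I 0, v) \<in> zspan ?T"
        by (intro zspan_base) (simp add: qadd_qcls[OF assms])
      from zspan_uminus[OF this] show ?thesis by (simp add: I 0)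
    qed
  qed
next
  \<comment> \<open>Conversely, choosing representatives inverts the projection: two representatives
    of a coset differ by an element of \<open>I\<close>, so the choice is immaterial modulo
    \<open>quot_rels I\<close>.\<close>
  define rep where "rep X = (SOME u. qcls I u = X)" for X
  define \<sigma> where "\<sigma> = frag_extend (\<lambda>(X, v). frag_of (rep X, v :: 'h))"
  have "qcls I (rep (qcls I u)) = qcls I u" for u
    unfolding rep_def by (rule someI) simp
  then have rep: "frag_of (rep (qcls I u), v) - frag_of (u, v) \<in> zspan (quot_rels I)" for u v
    by (intro quot_cong) (simp add: qcls_eq_iff[OF I])
  assume "?\<pi> z \<in> zspan ?T"
  then have "\<sigma> (?\<pi> z) \<in> zspan (quot_rels I)"
    unfolding \<sigma>_def
  proof (rule zspan_frag_map)
    fix w assume "w \<in> ?T"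
    then show "frag_extend (\<lambda>(X, v). frag_of (rep X, v)) w \<in> zspan (quot_rels I)"
    proof (cases rule: tensor_rels_cases)
      case (addl X Y v)
      then obtain x y where xy: "X = qcls I x" "Y = qcls I y" by blast
      from zspan_add[OF zspan_diff[OF zspan_diff[OF rep[of "x + y" v] rep[of x v]] rep[of y v]] quot_addl[of x y v]]
      show ?thesis by (simp add: addl xy qadd_qcls[OF I] frag_extend_diff frag_extend_add algebra_simps)
    next
      case (addr X v v')
      then show ?thesis using quot_addr by (simp add: frag_extend_diff)
    next
      case (act X a v)
      then obtain x where x: "X = qcls I x" by blast
      from zspan_add[OF zspan_diff[OF rep[of "t a * x" v] rep[of x "s a * v"]] quot_act[of a x v]]
      show ?thesis by (simp add: act x qact_qcls[OF I] frag_extend_diff)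
    qed
  qed
  moreover have "\<sigma> (?\<pi> z) - frag_extend frag_of z \<in> zspan (quot_rels I)"
    unfolding \<sigma>_def frag_extend_frag_extend
    by (rule frag_extend_cong_zspan) (auto intro: rep)
  ultimately show "z \<in> zspan (quot_rels I)"
    using zspan_cong[THEN iffD1] unfolding frag_extend_of_id by blast
qed

section \<open>The Galois connection between coinvariants and left ideals\<close>

lemma coinv_iff:
  assumes "left_ideal I"
  shows "x \<in> coinv s t D I \<longleftrightarrow> D x - frag_of (1, x) \<in> zspan (quot_rels I)"
  using zspan_qcls_iff[OF assms, of "D x - frag_of (1, x)"]
  by (simp add: coinv_def frag_extend_diff)

lemma coinv_mono:
  assumes "left_ideal I" "left_ideal J" "I \<subseteq> J"
  shows "coinv s t D I \<subseteq> coinv s t D J"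
proof
  fix x assume "x \<in> coinv s t D I"
  then have "D x - frag_of (1, x) \<in> zspan (quot_rels J)"
    unfolding coinv_iff[OF assms(1)] using assms(3) by (elim zspan_mono) (auto simp: quot_rels_def)
  then show "x \<in> coinv s t D J" by (simp add: coinv_iff[OF assms(2)])
qed

text \<open>Apply \<open>\<pi>(u) \<otimes> v \<mapsto> \<pi>(t(\<epsilon>(v)) u)\<close> to \<open>\<Sum> \<pi>(x\<^sub>1) \<otimes> x\<^sub>2 = \<pi>(1) \<otimes> x\<close>.\<close>

lemma coinv_diff_t_eps:
  assumes I: "left_ideal I" and x: "x \<in> coinv s t D I"
  shows "x - t (eps x) \<in> I"
proof -
  let ?e = "\<lambda>(u, v). t (eps v) * u"
  have "fsum_eval (D x - frag_of (1, x)) ?e \<in> I"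
  proof (rule fsum_eval_zspan)
    show "D x - frag_of (1, x) \<in> zspan (quot_rels I)" using x coinv_iff[OF I] by simp
    show "fsum_eval z ?e \<in> I" if "z \<in> quot_rels I" for z
      using that left_idealD(1,3)[OF I]
      by (cases rule: quot_rels_cases)
         (auto simp: fsum_eval_diff eps_add eps_s t_add t_mult ring_distribs mult.assoc)
  qed (use left_idealD[OF I] in auto)
  then show ?thesis by (simp add: fsum_eval_diff counit_right)
qed

text \<open>For coinvariant \<open>x\<close> with \<open>eps x = 0\<close>, the element
  \<open>x - t (eps x)\<close> of \<open>I\<close> is \<open>x\<close> itself.\<close>

lemma lmul_span_coinv_subset:
  assumes I: "left_ideal I"
  shows "lmul_span (plus_part eps (coinv s t D I)) \<subseteq> I"
proof (rule lmul_span_least[OF _ I])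
  have "t 0 = 0" using t_add[of 0 0] by simp
  then show "plus_part eps (coinv s t D I) \<subseteq> I"
    using coinv_diff_t_eps[OF I] by (fastforce simp: plus_part_def)
qed

text \<open>Here \<open>b\<^sub>0 - t(\<epsilon>(b\<^sub>0)) \<in> B\<^sup>+\<close>, so \<open>\<pi>(b\<^sub>0) \<otimes> b\<^sub>1 = \<pi>(1) \<otimes> s(\<epsilon>(b\<^sub>0)) b\<^sub>1\<close>.\<close>

lemma coinv_lmul_span_plus_part:
  assumes B: "\<And>x y. x \<in> B \<Longrightarrow> y \<in> B \<Longrightarrow> x - y \<in> B" "\<And>a. t a \<in> B"
    and w: "Poly_Mapping.keys w \<subseteq> B \<times> UNIV" "D b - w \<in> zspan (HH_rels s t UNIV)"
  shows "b \<in> coinv s t D (lmul_span (plus_part eps B))"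
proof -
  let ?J = "lmul_span (plus_part eps B)"
  let ?g = "\<lambda>(x, y). s (eps x) * y"
  \<comment> \<open>The map \<open>x \<otimes> y \<mapsto> s (eps x) * y\<close> respects the tensor
    relations, so the left counit law may be evaluated on \<open>w\<close> in place of
    \<open>D b\<close>.\<close>
  have "fsum_eval (D b - w) ?g \<in> {0}"
  proof (rule fsum_eval_zspan)
    show "D b - w \<in> zspan (quot_rels {})" using w(2) by (rule zspan_HH)
    show "fsum_eval z ?g \<in> {0}" if "z \<in> quot_rels {}" for z
      using that
      by (cases rule: quot_rels_cases)
         (auto simp: fsum_eval_diff eps_add eps_t s_add s_mult ring_distribs mult.assoc)
  qed auto
  then have eval: "fsum_eval w ?g = b" by (simp add: fsum_eval_diff counit_left)
  have "w - frag_extend (\<lambda>k. frag_of (1, ?g k)) w \<in> zspan (quot_rels ?J)"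
  proof (subst frag_expansion[of w], rule frag_extend_cong_zspan, clarify)
    fix x y assume "(x, y) \<in> Poly_Mapping.keys w"
    then have "x \<in> B" using w(1) by auto
    \<comment> \<open>The factor \<open>1\<close> gives the form to which right linearity of
      \<open>eps\<close>, and then the balancing relation \<open>quot_act\<close>, apply.\<close>
    have "eps (x - t (eps x) * 1) = 0" by (simp only: eps_diff eps_t eps_1) simp
    then have "x - t (eps x) * 1 \<in> plus_part eps B"
      using B \<open>x \<in> B\<close> by (simp add: plus_part_def)
    then have "frag_of (x, y) - frag_of (t (eps x) * 1, y) \<in> zspan (quot_rels ?J)"
      using lmul_span_superset by (intro quot_cong) auto
    from zspan_trans[OF this quot_act]
    show "frag_of (x, y) - frag_of (1, s (eps x) * y) \<in> zspan (quot_rels ?J)" .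
  qed
  moreover have "frag_of (1, fsum_eval w ?g) - frag_extend (\<lambda>k. frag_of (1, ?g k)) w \<in> zspan (quot_rels ?J)"
    by (rule additive_mod_fsum_eval) (rule quot_addr)
  ultimately have "w - frag_of (1, b) \<in> zspan (quot_rels ?J)"
    unfolding eval by (blast intro: zspan_trans zspan_sym)
  with zspan_HH[OF w(2)] have "D b - frag_of (1, b) \<in> zspan (quot_rels ?J)"
    by (rule zspan_trans)
  then show ?thesis by (simp add: coinv_iff left_ideal_lmul_span)
qed

section \<open>The comultiplication of coinvariants\<close>

lemma module_presentation_quot_rels:
  "module_presentation (zspan (quot_rels I)) (\<lambda>m a. frag_extend (\<lambda>(x, y). frag_of (x, t a * y)) m)"
proof
  fix z a assume "z \<in> zspan (quot_rels I)"
  then show "frag_extend (\<lambda>(x, y). frag_of (x, t a * y)) z \<in> zspan (quot_rels I)"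
  proof (rule zspan_frag_map)
    fix w assume "w \<in> quot_rels I"
    then show "frag_extend (\<lambda>(x, y). frag_of (x, t a * y)) w \<in> zspan (quot_rels I)"
    proof (cases rule: quot_rels_cases)
      case (addl x x' y)
      then show ?thesis using quot_addl by (simp add: frag_extend_diff)
    next
      case (addr x y y')
      then show ?thesis using quot_addr by (simp add: frag_extend_diff distrib_left)
    next
      case (act b x y)
      \<comment> \<open>The action on the second factor respects balancing because the images of
        \<open>s\<close> and \<open>t\<close> commute.\<close>
      have "t a * (s b * y) = s b * (t a * y)" by (metis mult.assoc st_commute)
      then show ?thesis using quot_act by (simp add: act frag_extend_diff)
    next
      case (I u v)
      then show ?thesis using quot_I by simp
    qed
  qed
next
  fix z a b
  \<comment> \<open>Distributivity in the scalar comes from additivity in the second tensor factor,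
    so it holds only modulo \<open>quot_rels I\<close>; this is why the locale states
    \<open>act_distrib\<close> modulo \<open>R\<close>.\<close>
  have "frag_extend (\<lambda>k. (case k of (x, y) \<Rightarrow> frag_of (x, t (a + b) * y))
      - (case k of (x, y) \<Rightarrow> frag_of (x, t a * y)) - (case k of (x, y) \<Rightarrow> frag_of (x, t b * y))) z
      \<in> zspan (quot_rels I)"
    by (rule zspan_frag_extend) (auto simp: t_add distrib_right intro: quot_addr)
  then show "frag_extend (\<lambda>(x, y). frag_of (x, t (a + b) * y)) z
      - frag_extend (\<lambda>(x, y). frag_of (x, t a * y)) z
      - frag_extend (\<lambda>(x, y). frag_of (x, t b * y)) z \<in> zspan (quot_rels I)"
    unfolding frag_extend_diff_fun .
qed (auto simp: frag_extend_add frag_extend_frag_extend case_prod_unfold t_mult t_1 mult.assoc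
    frag_extend_of_id intro: zspan_zero zspan_diff)

text \<open>\<open>coinv s t D I\<close> is the kernel of the \<open>A\<close>-linear map \<open>f(x) = \<Sum> \<pi>(x\<^sub>1) \<otimes> x\<^sub>2 - \<pi>(1) \<otimes> x\<close>.
  Coassociativity gives \<open>\<Sum> f(b\<^sub>1) \<otimes> b\<^sub>2 = 0\<close> for coinvariant \<open>b\<close>; flatness makes this an equation
  in \<open>f(\<H>) \<otimes> \<H>\<close>, where \<open>f(\<H>)\<close> is \<open>\<H>\<close> modulo the coinvariants.\<close>

lemma D_coinv:
  assumes flat: "flat_s s" and I: "left_ideal I" and b: "b \<in> coinv s t D I"
  shows "D b \<in> zspan (quot_rels (coinv s t D I))"
proof -
  let ?R = "zspan (quot_rels I)"
  let ?act = "\<lambda>m a. frag_extend (\<lambda>(x, y). frag_of (x, t a * y)) m"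
  interpret M: module_presentation ?R ?act by (rule module_presentation_quot_rels)
  let ?T = "zspan (M.trels s UNIV)"
  define B where "B = coinv s t D I"
  define f where "f x = D x - frag_of (1, x)" for x
  have f_add: "f (x + y) - f x - f y \<in> ?R" for x y
    using zspan_diff[OF zspan_HH[OF D_add[of x y]] quot_addr[of 1 x y]]
    by (simp add: f_def algebra_simps)
  have f_diff: "f (x - y) - (f x - f y) \<in> ?R" for x y
    by (rule additive_mod_diff) (rule f_add)
  have f_0: "f 0 \<in> ?R" by (rule additive_mod_zero) (rule f_add)
  have f_act: "f (t a * x) - ?act (f x) a \<in> ?R" for a x
    using zspan_HH[OF D_t[of a x]] by (simp add: f_def frag_extend_diff)
  have B_iff: "x \<in> B \<longleftrightarrow> f x \<in> ?R" for x
    by (simp add: B_def f_def coinv_iff[OF I])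
  define Z where "Z = frag_extend (\<lambda>(x, y). frag_of (f x, y)) (D b)"
  have R1: "frag_of (u, v) - frag_of (u', v') \<in> zspan (quot_rels I) \<Longrightarrow>
      frag_of (frag_of (u, v), h) - frag_of (frag_of (u', v'), h) \<in> ?T" for u v u' v' h
    by (rule M.trels_cong) (auto simp: M.submod_def)
  have "Z \<in> ?T"
  proof -
    \<comment> \<open>\<open>\<theta>\<close> regroups \<open>x \<otimes> y \<otimes> z\<close> as
      \<open>(x \<otimes> y) \<otimes> z\<close>, with \<open>x \<otimes> y\<close> read in
      \<open>\<H>/I \<otimes> \<H>\<close>, and carries coassociativity there.\<close>
    define \<theta> where "\<theta> = frag_extend (\<lambda>(x, y, z). frag_of (frag_of (x :: 'h, y :: 'h), z :: 'h))"
    have \<theta>_H3: "\<theta> w \<in> ?T" if "w \<in> H3_rels s t UNIV" for w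
    proof -
      from that consider
        x x' y z where "w = frag_of (x + x', y, z) - frag_of (x, y, z) - frag_of (x', y, z)"
      | x y y' z where "w = frag_of (x, y + y', z) - frag_of (x, y, z) - frag_of (x, y', z)"
      | x y z z' where "w = frag_of (x, y, z + z') - frag_of (x, y, z) - frag_of (x, y, z')"
      | x a y z where "w = frag_of (t a * x, y, z) - frag_of (x, s a * y, z)"
      | x a y z where "w = frag_of (x, t a * y, z) - frag_of (x, y, s a * z)"
        unfolding H3_rels_def by blast
      then show ?thesis
      proof cases
        case (1 x x' y z)
        then show ?thesis using M.trels_diff2[OF quot_addl] by (simp add: \<theta>_def frag_extend_diff)
      next
        case (2 x y y' z)
        then show ?thesis using M.trels_diff2[OF quot_addr] by (simp add: \<theta>_def frag_extend_diff)
      next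
        case (3 x y z z')
        then show ?thesis using M.trels_addr[OF UNIV_I] by (simp add: \<theta>_def frag_extend_diff)
      next
        case (4 x a y z)
        then show ?thesis using R1[OF quot_act] by (simp add: \<theta>_def frag_extend_diff)
      next
        case (5 x a y z)
        then show ?thesis using M.trels_act[of "frag_of (x, y)" UNIV a z s]
          by (simp add: \<theta>_def frag_extend_diff)
      qed
    qed
    \<comment> \<open>\<open>\<mu> x\<close> inserts \<open>x\<close> on the left of an element of
      \<open>\<H> \<otimes> \<H>\<close>. Thus \<open>\<kappa>\<close> is
      \<open>\<pi> \<otimes> \<Delta>\<close>, regrouped; \<open>\<kappa>_quot\<close> makes it well
      defined on \<open>\<H>/I \<otimes> \<H>\<close>.\<close>
    define \<mu> where "\<mu> x = frag_extend (\<lambda>(u, v). frag_of (frag_of (x :: 'h, u :: 'h), v :: 'h))" for x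
    define \<kappa> where "\<kappa> = frag_extend (\<lambda>(x, y). \<mu> x (D y))"
    have \<mu>_HH: "\<mu> x w \<in> ?T" if "w \<in> zspan (HH_rels s t UNIV)" for x w
      using that unfolding \<mu>_def quot_rels_empty[symmetric]
    proof (rule zspan_frag_map)
      fix w assume "w \<in> quot_rels {}"
      then show "frag_extend (\<lambda>(u, v). frag_of (frag_of (x, u), v)) w \<in> ?T"
      proof (cases rule: quot_rels_cases)
        case (addl u u' v)
        then show ?thesis using M.trels_diff2[OF quot_addr] by (simp add: frag_extend_diff)
      next
        case (addr u v v')
        then show ?thesis using M.trels_addr[OF UNIV_I] by (simp add: frag_extend_diff)
      next
        case (act a u v)
        then show ?thesis using M.trels_act[of "frag_of (x, u)" UNIV a v s]
          by (simp add: frag_extend_diff)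
      qed auto
    qed
    have \<kappa>_quot: "\<kappa> w \<in> ?T" if "w \<in> quot_rels I" for w
      using that
    proof (cases rule: quot_rels_cases)
      case (addl x x' y)
      show ?thesis
        unfolding addl \<kappa>_def \<mu>_def frag_extend_diff frag_extend_of prod.case frag_extend_diff_fun
        by (rule zspan_frag_extend) (auto intro: M.trels_diff2 quot_addl)
    next
      case (addr x y y')
      have "\<mu> x (D (y + y') - (D y + D y')) \<in> ?T" by (rule \<mu>_HH) (rule D_add)
      then show ?thesis
        by (simp add: addr \<kappa>_def \<mu>_def frag_extend_diff frag_extend_add diff_diff_eq)
    next
      case (act a x y)
      have "\<mu> x (D (s a * y)) - \<mu> x (frag_extend (\<lambda>(u, v). frag_of (s a * u, v)) (D y)) \<in> ?T"
        using \<mu>_HH[OF D_s, of x a y] by (simp add: \<mu>_def frag_extend_diff)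
      moreover have "\<mu> (t a * x) (D y) - \<mu> x (frag_extend (\<lambda>(u, v). frag_of (s a * u, v)) (D y)) \<in> ?T"
        unfolding \<mu>_def frag_extend_frag_extend
        by (rule frag_extend_cong_zspan) (auto intro!: R1 quot_act)
      ultimately have "\<mu> (t a * x) (D y) - \<mu> x (D (s a * y)) \<in> ?T"
        by (blast intro: zspan_trans zspan_sym)
      then show ?thesis by (simp add: act \<kappa>_def frag_extend_diff)
    next
      case (I u v)
      show ?thesis
        unfolding I \<kappa>_def \<mu>_def frag_extend_of prod.case
        by (rule zspan_frag_extend) (auto intro!: M.trels_R quot_I I)
    qed
    let ?L = "frag_extend (\<lambda>(x, y). frag_extend (\<lambda>(u, v). frag_of (u, v, y)) (D x)) (D b)"
    let ?N = "frag_extend (\<lambda>(x, y). frag_extend (\<lambda>(u, v). frag_of (x, u, v)) (D y)) (D b)"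
    \<comment> \<open>Below, \<open>1\<close> is coassociativity, \<open>2\<close> is
      \<open>\<kappa>\<close> applied to the coinvariance of \<open>b\<close>, and \<open>3\<close>
      expands \<open>f\<close> inside \<open>Z\<close>; together they give
      \<open>Z = 0\<close>.\<close>
    have "\<theta> (?L - ?N) \<in> ?T"
      using coassoc \<theta>_H3 unfolding \<theta>_def by (rule zspan_frag_map)
    moreover have "\<theta> ?N = \<kappa> (D b)"
      by (simp add: \<theta>_def \<kappa>_def \<mu>_def frag_extend_frag_extend case_prod_unfold)
    ultimately have 1: "\<theta> ?L - \<kappa> (D b) \<in> ?T"
      by (simp add: \<theta>_def frag_extend_diff)
    have "\<kappa> (D b - frag_of (1, b)) \<in> ?T"
      using b[unfolded coinv_iff[OF I]] \<kappa>_quot unfolding \<kappa>_def by (rule zspan_frag_map)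
    then have 2: "\<kappa> (D b) - \<mu> 1 (D b) \<in> ?T" by (simp add: \<kappa>_def frag_extend_diff)
    have \<theta>_L: "\<theta> ?L = frag_extend (\<lambda>p. frag_extend (\<lambda>k. frag_of (frag_of k, snd p)) (D (fst p))) (D b)"
      by (simp add: \<theta>_def frag_extend_frag_extend case_prod_unfold)
    have Z_eq: "Z = frag_extend (\<lambda>p. frag_of (f (fst p), snd p)) (D b)"
      by (simp add: Z_def case_prod_unfold)
    have \<mu>_eq: "\<mu> 1 (D b) = frag_extend (\<lambda>p. frag_of (frag_of (1, fst p), snd p)) (D b)"
      by (simp add: \<mu>_def case_prod_unfold)
    have 3: "Z - (\<theta> ?L - \<mu> 1 (D b)) \<in> ?T"
      unfolding Z_eq \<theta>_L \<mu>_eq frag_extend_diff_fun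
    proof (rule zspan_frag_extend)
      fix p :: "'h \<times> 'h"
      define x y where "x = fst p" and "y = snd p"
      have "frag_of (D x - frag_of (1, x), y) - (frag_of (D x, y) - frag_of (frag_of (1, x), y)) \<in> ?T"
        by (rule M.trels_diffl) (auto simp: M.submod_def)
      moreover have "frag_of (D x, y) - frag_extend (\<lambda>k. frag_of (frag_of k, y)) (D x) \<in> ?T"
        using M.trels_additive[of "D x" frag_of] by (simp add: fsum_eval_frag_of)
      ultimately have "(frag_of (D x - frag_of (1, x), y) - (frag_of (D x, y) - frag_of (frag_of (1, x), y)))
          + (frag_of (D x, y) - frag_extend (\<lambda>k. frag_of (frag_of k, y)) (D x)) \<in> ?T"
        by (rule zspan_add)
      then show "frag_of (f (fst p), snd p) - (frag_extend (\<lambda>k. frag_of (frag_of k, snd p)) (D (fst p))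
            - frag_of (frag_of (1, fst p), snd p)) \<in> ?T"
        by (simp add: f_def x_def y_def algebra_simps)
    qed
    have "\<theta> ?L - \<mu> 1 (D b) \<in> ?T" using 1 2 by (rule zspan_trans)
    from zspan_add[OF 3 this] show ?thesis by simp
  qed
  \<comment> \<open>The image of \<open>f\<close> enlarged by \<open>R\<close>; it is a submodule
    because \<open>f\<close> is linear modulo \<open>R\<close>.\<close>
  define P where "P = {m. \<exists>x. m - f x \<in> ?R}"
  have P: "M.submod P"
    unfolding M.submod_def
  proof (intro conjI ballI allI)
    show "?R \<subseteq> P" unfolding P_def using zspan_diff f_0 by blast
    fix m assume "m \<in> P"
    then obtain x where x: "m - f x \<in> ?R" by (auto simp: P_def)
    have "?act m a - f (t a * x) \<in> ?R" for a
      using zspan_diff[OF M.R_act[OF x, of a] f_act[of a x]] by (simp add: M.act_diff)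
    then show "?act m a \<in> P" for a by (auto simp: P_def)
    fix n assume "n \<in> P"
    then obtain y where y: "n - f y \<in> ?R" by (auto simp: P_def)
    have "(m - n) - f (x - y) \<in> ?R"
      using zspan_diff[OF zspan_diff[OF x y] f_diff[of x y]] by (simp add: algebra_simps)
    then show "m - n \<in> P" by (auto simp: P_def)
  qed
  have fP: "f x \<in> P" for x
    unfolding P_def using zspan_zero by (auto intro!: exI[of _ x])
  have "Poly_Mapping.keys Z \<subseteq> P \<times> UNIV"
    unfolding Z_def by (rule order_trans[OF keys_frag_extend]) (auto simp: fP)
  then have "Z \<in> zspan (M.trels s P)"
    using \<open>Z \<in> ?T\<close> by (rule M.flat_injective[OF flat inj_s s_add s_mult s_1 P])
  \<comment> \<open>\<open>\<sigma>\<close> chooses preimages under \<open>f\<close>. These are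
    unique up to the kernel \<open>B\<close>, so
    \<open>m \<otimes> h \<mapsto> \<sigma> m \<otimes> h\<close> is well defined modulo
    \<open>quot_rels B\<close>.\<close>
  define \<sigma> where "\<sigma> m = (SOME x. m - f x \<in> ?R)" for m
  have \<sigma>: "m - f (\<sigma> m) \<in> ?R" if "m \<in> P" for m
    using that someI_ex[of "\<lambda>x. m - f x \<in> ?R"] by (simp add: P_def \<sigma>_def)
  have \<sigma>_cong: "frag_of (\<sigma> m, h) - frag_of (x, h) \<in> zspan (quot_rels B)"
    if "m \<in> P" "m - f x \<in> ?R" for m x h
  proof (rule quot_cong)
    have "f (\<sigma> m - x) \<in> ?R"
      using zspan_add[OF f_diff[of "\<sigma> m" x] zspan_diff[OF that(2) \<sigma>[OF that(1)]]] by simp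
    then show "\<sigma> m - x \<in> B" by (simp add: B_iff)
  qed
  define \<rho> where "\<rho> = frag_extend (\<lambda>(m, h). frag_of (\<sigma> m, h :: 'h))"
  have "\<rho> Z \<in> zspan (quot_rels B)"
    using \<open>Z \<in> zspan (M.trels s P)\<close> unfolding \<rho>_def
  proof (rule zspan_frag_map)
    fix w assume "w \<in> M.trels s P"
    then show "frag_extend (\<lambda>(m, h). frag_of (\<sigma> m, h)) w \<in> zspan (quot_rels B)"
    proof (cases rule: M.trels_cases)
      case (addl m m' h)
      have "m + m' - f (\<sigma> m + \<sigma> m') \<in> ?R"
        using zspan_diff[OF zspan_add[OF \<sigma>[OF addl(1)] \<sigma>[OF addl(2)]] f_add[of "\<sigma> m" "\<sigma> m'"]]
        by (simp add: algebra_simps)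
      then have "frag_of (\<sigma> (m + m'), h) - frag_of (\<sigma> m + \<sigma> m', h) \<in> zspan (quot_rels B)"
        using addl M.submodD(6)[OF P] by (intro \<sigma>_cong) auto
      from zspan_add[OF this quot_addl[of "\<sigma> m" "\<sigma> m'" h]] show ?thesis
        by (simp add: addl frag_extend_diff frag_extend_add algebra_simps)
    next
      case (addr m h h')
      then show ?thesis using quot_addr by (simp add: frag_extend_diff)
    next
      case (act m a h)
      have "?act m a - f (t a * \<sigma> m) \<in> ?R"
        using zspan_diff[OF M.R_act[OF \<sigma>[OF act(1)], of a] f_act[of a "\<sigma> m"]] by (simp add: M.act_diff)
      then have "frag_of (\<sigma> (?act m a), h) - frag_of (t a * \<sigma> m, h) \<in> zspan (quot_rels B)"
        using act M.submodD(3)[OF P] by (intro \<sigma>_cong) auto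
      from zspan_trans[OF this quot_act] show ?thesis
        by (simp add: act frag_extend_diff)
    next
      case (R r h)
      have "f (\<sigma> r) \<in> ?R"
        using zspan_diff[OF R(1) \<sigma>[OF M.submodD(1)[OF P R(1)]]] by simp
      then show ?thesis by (simp add: R B_iff quot_I)
    qed
  qed
  \<comment> \<open>Since \<open>x\<close> is itself a preimage of \<open>f x\<close>,
    \<open>\<rho>\<close> takes \<open>Z\<close> back to \<open>D b\<close>, which therefore
    vanishes modulo \<open>quot_rels B\<close>.\<close>
  moreover have "\<rho> Z - frag_extend frag_of (D b) \<in> zspan (quot_rels B)"
    unfolding \<rho>_def Z_def frag_extend_frag_extend
    by (rule frag_extend_cong_zspan) (auto intro!: \<sigma>_cong fP zspan_zero)
  ultimately have "D b \<in> zspan (quot_rels B)"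
    using zspan_cong[THEN iffD1] unfolding frag_extend_of_id by blast
  then show ?thesis by (simp add: B_def)
qed

section \<open>The two identities\<close>

lemma coinv_diff:
  assumes I: "left_ideal I" and x: "x \<in> coinv s t D I" and y: "y \<in> coinv s t D I"
  shows "x - y \<in> coinv s t D I"
proof -
  let ?f = "\<lambda>x. D x - frag_of (1, x)"
  have "?f (x - y + y) - ?f (x - y) - ?f y \<in> zspan (quot_rels I)"
    using zspan_diff[OF zspan_HH[OF D_add[of "x - y" y]] quot_addr[of 1 "x - y" y]]
    by (simp add: algebra_simps)
  then have "?f (x - y) - (?f x - ?f y) \<in> zspan (quot_rels I)"
    by (rule additive_mod_diff)
  moreover have "?f x - ?f y \<in> zspan (quot_rels I)"
    using zspan_diff x y unfolding coinv_iff[OF I] by blast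
  ultimately have "?f (x - y) \<in> zspan (quot_rels I)" by (rule zspan_cong[THEN iffD2])
  then show ?thesis by (simp add: coinv_iff[OF I])
qed

text \<open>\<open>\<Delta>\<close> is linear for \<open>t\<close> acting on the second factor, so
  \<open>\<Delta>(1) = 1 \<otimes> 1\<close> yields
  \<open>\<Delta>(t a) = 1 \<otimes> t a\<close>.\<close>

lemma t_in_coinv:
  assumes I: "left_ideal I"
  shows "t a \<in> coinv s t D I"
proof -
  let ?m = "frag_extend (\<lambda>(x, y). frag_of (x, t a * y))"
  interpret M: module_presentation "zspan (quot_rels I)" "\<lambda>m a. frag_extend (\<lambda>(x, y). frag_of (x, t a * y)) m"
    by (rule module_presentation_quot_rels)
  have "D (t a * 1) - ?m (D 1) \<in> zspan (quot_rels I)"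
    by (rule zspan_HH[OF D_t])
  moreover have "?m (D 1) - frag_of (1, t a) \<in> zspan (quot_rels I)"
    using M.R_act[OF zspan_HH[OF D_1], of a] by (simp add: frag_extend_diff)
  ultimately have "D (t a * 1) - frag_of (1, t a) \<in> zspan (quot_rels I)"
    by (rule zspan_trans)
  then show ?thesis by (simp add: coinv_iff[OF I])
qed

text \<open>With \<open>B\<close> the coinvariants, one inclusion is monotonicity applied to
  \<open>\<H>B\<^sup>+ \<subseteq> I\<close>. For the other, \<open>D_coinv\<close> and right
  exactness replace \<open>D b\<close> by a sum with left entries in \<open>B\<close>, as
  \<open>coinv_lmul_span_plus_part\<close> demands.\<close>

lemma coinv_lmul_span_coinv:
  assumes flat: "flat_s s" and I: "left_ideal I"
  shows "coinv s t D (lmul_span (plus_part eps (coinv s t D I))) = coinv s t D I"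
proof
  show "coinv s t D (lmul_span (plus_part eps (coinv s t D I))) \<subseteq> coinv s t D I"
    by (intro coinv_mono left_ideal_lmul_span lmul_span_coinv_subset I)
  show "coinv s t D I \<subseteq> coinv s t D (lmul_span (plus_part eps (coinv s t D I)))"
  proof
    fix b assume "b \<in> coinv s t D I"
    then obtain w where w: "Poly_Mapping.keys w \<subseteq> coinv s t D I \<times> UNIV"
      "D b - w \<in> zspan (HH_rels s t UNIV)"
      using zspan_quot_rels_decompose[OF D_coinv[OF flat I]] by blast
    then show "b \<in> coinv s t D (lmul_span (plus_part eps (coinv s t D I)))"
      by (intro coinv_lmul_span_plus_part coinv_diff t_in_coinv I)
  qed
qed

text \<open>The coaction \<open>delta b\<close> represents \<open>D b\<close> with left entries in
  \<open>B\<close>, so \<open>B\<close> consists of coinvariants. Generating left ideals from the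
  plus parts gives one inclusion, \<open>lmul_span_coinv_subset\<close> the other.\<close>

lemma lmul_span_coinv_lmul_span:
  assumes B: "comod_subring smH s t D eps B delta"
  shows "lmul_span (plus_part eps (coinv s t D (lmul_span (plus_part eps B))))
    = lmul_span (plus_part eps B)"
proof
  show "lmul_span (plus_part eps (coinv s t D (lmul_span (plus_part eps B)))) \<subseteq> lmul_span (plus_part eps B)"
    by (intro lmul_span_coinv_subset left_ideal_lmul_span)
  have "B \<subseteq> coinv s t D (lmul_span (plus_part eps B))"
  proof
    fix b assume b: "b \<in> B"
    have diff: "x - y \<in> B" if "x \<in> B" "y \<in> B" for x y
      using B that unfolding comod_subring_def by (metis add_uminus_conv_diff)
    have t: "t a \<in> B" for a using B unfolding comod_subring_def by blast
    have keys: "Poly_Mapping.keys (delta b) \<subseteq> B \<times> UNIV"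
      and delta: "delta b - D b \<in> zspan (HH_rels s t UNIV)"
      using B b unfolding comod_subring_def by blast+
    show "b \<in> coinv s t D (lmul_span (plus_part eps B))"
      by (rule coinv_lmul_span_plus_part[OF diff t keys zspan_sym[OF delta]])
  qed
  then show "lmul_span (plus_part eps B)
      \<subseteq> lmul_span (plus_part eps (coinv s t D (lmul_span (plus_part eps B))))"
    by (intro lmul_span_least left_ideal_lmul_span order_trans[OF _ lmul_span_superset])
       (auto simp: plus_part_def)
qed

end

theorem theorem2p9:
  fixes smA :: "'k::field \<Rightarrow> 'a::{ring,monoid_mult} \<Rightarrow> 'a"
    and smH :: "'k \<Rightarrow> 'h::{ring,monoid_mult} \<Rightarrow> 'h"
    and s t :: "'a \<Rightarrow> 'h"
    and D :: "'h \<Rightarrow> ('h \<times> 'h) \<Rightarrow>\<^sub>0 int"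
    and eps :: "'h \<Rightarrow> 'a"
  assumes bialg: "left_bialgebroid smA smH s t D eps"
    and flat: "flat_s s"
  shows "(\<forall>I. lideal_coideal s t D eps I \<longrightarrow>
            coinv s t D I = coinv s t D (lmul_span (plus_part eps (coinv s t D I))))
       \<and> (\<forall>B delta. comod_subring smH s t D eps B delta \<longrightarrow>
            lmul_span (plus_part eps B)
              = lmul_span (plus_part eps (coinv s t D (lmul_span (plus_part eps B)))))"
proof -
  interpret bialgebroid smA smH s t D eps by (rule bialgebroid.intro) (rule bialg)
  have "left_ideal I" if "lideal_coideal s t D eps I" for I
    using that unfolding lideal_coideal_def left_ideal_def by (metis add_uminus_conv_diff)
  then show ?thesis
    using coinv_lmul_span_coinv[OF flat] lmul_span_coinv_lmul_span by simp
qed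

end
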